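(* Let $\boldsymbol m_h^n\in\boldsymbol{\mathcal M}_h$ (and $\boldsymbol m_h^{n-1}\in\boldsymbol{\mathcal M}_h$) be given. Let $\mathbf A_k[\boldsymbol m_h^n]\in\mathbb R^{3N\times3N}$, $\mathbf b[\boldsymbol m_h^n]\in\mathbb R^{3N}$ and the block-diagonal matrix $\mathbf Q[\boldsymbol m_h^n]\in\mathbb R^{3N\times 2N}$ be as defined in the context. Then the matrix $\mathbf Q[\boldsymbol m_h^n]^T\mathbf A_k[\boldsymbol m_h^n]\mathbf Q[\boldsymbol m_h^n]\in\mathbb R^{2N\times2N}$ is positive definite (i.e. $\mathbf x\cdot \mathbf Q^T\mathbf A_k\mathbf Q\,\mathbf x>0$ for all $\mathbf x\neq 0$; symmetry is not claimed) and, in particular, regular. Moreover, the unique solution $\mathbf x\in\mathbb R^{2N}$ of $$\big(\mathbf Q[\boldsymbol m_h^n]^T\mathbf A_k[\boldsymbol m_h^n]\mathbf Q[\boldsymbol m_h^n]\big)\,\mathbf x=\mathbf Q[\boldsymbol m_h^n]^T\,\mathbf b[\boldsymbol m_h^n]$$ and the unique solution $\boldsymbol v_h^n\in\boldsymbol{\mathcal K}_h[\boldsymbol m_h^n]$ of the variational formulation $$\langle W_k(\lambda_h^n)\boldsymbol v_h^n,\boldsymbol\varphi_h\rangle_\Omega+\langle\boldsymbol m_h^n\times\boldsymbol v_h^n,\boldsymbol\varphi_h\rangle_\Omega+\beta(k)k\,\langle\nabla\boldsymbol v_h^n,\nabla\boldsymbol\varphi_h\rangle_\Omega=-\ell_{\rm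 ex}^2\langle\nabla\boldsymbol m_h^n,\nabla\boldsymbol\varphi_h\rangle_\Omega+\langle\boldsymbol L_h(\boldsymbol m_h^n,\boldsymbol m_h^{n-1}),\boldsymbol\varphi_h\rangle_\Omega\quad\text{for all }\boldsymbol\varphi_h\in\boldsymbol{\mathcal K}_h[\boldsymbol m_h^n]$$ satisfy $$\boldsymbol v_h^n=\sum_{j=1}^{3N}\mathbf v_j\,\boldsymbol\phi_j\quad\text{with}\quad \mathbf v:=\mathbf Q[\boldsymbol m_h^n]\,\mathbf x\in\mathbb R^{3N}.$$
   Context: Mesh and spaces: $\Omega\subset\mathbb R^3$ is a bounded Lipschitz domain, $\mathcal T_h$ a triangulation of $\Omega$ into tetrahedra which is $C_{\rm mesh}$-quasi-uniform with mesh-size $h>0$, i.e. $h\le|K|^{1/3}\le\operatorname{diam}(K)\le C_{\rm mesh}h$ for all $K\in\mathcal T_h$. $\mathcal S_h$ is the space of continuous functions on $\Omega$ that are affine on each element, $\mathcal N_h=\{z_1,\dots,z_N\}$ the set of nodes, $\varphi_j\in\mathcal S_h$ the hat functions ($\varphi_j(z_i)=\delta_{ij}$), $\boldsymbol{\mathcal S}_h=(\mathcal S_h)^3$ with basis $\boldsymbol\phi_{3(j-1)+\ell}:=\varphi_j\mathbf e_\ell$ ($j=1,\dots,N$, $\ell=1,2,3$). $\boldsymbol{\mathcal M}_h:=\{\boldsymbol\varphi_h\in\boldsymbol{\mathcal S}_h: |\boldsymbol\varphi_h(z)|=1\ \forall z\in\mathcal N_h\}$; for $\boldsymbol\mu_h\in\boldsymbol{\mathcal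 M}_h$, $\boldsymbol{\mathcal K}_h[\boldsymbol\mu_h]:=\{\boldsymbol\varphi_h\in\boldsymbol{\mathcal S}_h:\boldsymbol\varphi_h(z)\cdot\boldsymbol\mu_h(z)=0\ \forall z\in\mathcal N_h\}$. $\langle\cdot,\cdot\rangle_\Omega$ is the $L^2(\Omega)$-scalar product (also for vector- and matrix-valued functions). Data: $\alpha\in(0,1]$, $\ell_{\rm ex}>0$, $T>0$, time-step size $k=T/M$ with $M\in\mathbb N$, $t_n=kn$, $0\le n<M$. $\boldsymbol\pi:H^1(\Omega)^3\to L^2(\Omega)^3$ is a bounded operator, $\boldsymbol f\in C^1([0,T],L^2(\Omega)^3)$. $\beta:\mathbb R_{>0}\to\mathbb R_{>0}$ and the (bounded, measurable) functions $W_k:\mathbb R\to\mathbb R_{>0}$ satisfy $\lim_{k\to0}\|W_k-\alpha\|_{L^\infty(\mathbb R)}=0$, $\inf_{k>0}\inf_{s\in\mathbb R}W_k(s)\ge\alpha/2>0$, $\lim_{k\to0}\beta(k)k=0$. $\lambda_h^n:=-\ell_{\rm ex}^2|\nabla\boldsymbol m_h^n|^2+(\boldsymbol f(t_n)+\boldsymbol\pi(\boldsymbol m_h^n))\cdot\boldsymbol m_h^n$. $\boldsymbol L_h(\boldsymbol m_h^n,\boldsymbol m_h^{n-1})\in L^2(\Omega)^3$ is a given function. Matrices: $\mathbf M_k[\boldsymbol m_h^n]_{ij}:=\langle(W_k(\lambda_h^n)/\alpha)\boldsymbol\phi_i,\boldsymbol\phi_j\rangle_\Omega$, $\mathbf L_{ij}:=\langle\nabla\boldsymbol\phi_i,\nabla\boldsymbol\phi_j\rangle_\Omega$,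 $\mathbf S[\boldsymbol m_h^n]_{ij}:=\langle\boldsymbol m_h^n\times\boldsymbol\phi_i,\boldsymbol\phi_j\rangle_\Omega$, all in $\mathbb R^{3N\times3N}$, $\mathbf A_k[\boldsymbol m_h^n]:=\alpha\mathbf M_k[\boldsymbol m_h^n]+\beta(k)k\,\mathbf L-\mathbf S[\boldsymbol m_h^n]$, and $\mathbf b[\boldsymbol m_h^n]_j:=-\ell_{\rm ex}^2\langle\nabla\boldsymbol m_h^n,\nabla\boldsymbol\phi_j\rangle_\Omega+\langle\boldsymbol L_h(\boldsymbol m_h^n,\boldsymbol m_h^{n-1}),\boldsymbol\phi_j\rangle_\Omega$. Householder matrices: for $\mathbf m\in\mathbb R^3$ with $|\mathbf m|=1$, $\widetilde{\mathbf H}[\mathbf m]:=\mathbf I-2\mathbf w\mathbf w^T$ with $\mathbf w:=(\mathbf m+\mathbf e_3)/|\mathbf m+\mathbf e_3|$ if $\mathbf m\ne-\mathbf e_3$, and $\widetilde{\mathbf H}[-\mathbf e_3]:=[\mathbf e_1,\mathbf e_2,-\mathbf e_3]$; $\mathbf H[\mathbf m]:=[\widetilde{\mathbf H}[\mathbf m]\mathbf e_1,\widetilde{\mathbf H}[\mathbf m]\mathbf e_2]\in\mathbb R^{3\times2}$. $\mathbf T_n\in\mathbb R^{3\times3}$ is a fixed matrix with $\mathbf T_n=\mathbf T_n^{-1}=\mathbf T_n^T$. $\mathbf Q[\boldsymbol m_h^n]\in\mathbb R^{3N\times2N}$ is block-diagonal with $i$-th diagonal block $\mathbf T_n\mathbf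 H[\mathbf T_n\boldsymbol m_h^n(z_i)]\in\mathbb R^{3\times2}$, $i=1,\dots,N$. *)

theory Defs
  imports
    "HOL-Analysis.Analysis"
    "HOL-Probability.Essential_Supremum"
    "Jordan_Normal_Form.Matrix"
begin

text \<open>
  Points and values live in \<^typ>\<open>real^3\<close>; the coefficient space, whose dimension depends on the
  number \<open>N\<close> of nodes, uses \<open>Jordan_Normal_Form.Matrix\<close> with indices starting at \<open>0\<close>. The
  infix \<open>$\<close> is kept for \<^const>\<open>vec_nth\<close>.
\<close>

no_notation vec_index (infixl "$" 100)
no_notation scalar_prod (infix "\<bullet>" 70)


section \<open>Lebesgue and Sobolev spaces\<close>

definition L2_space :: "(real^3) set \<Rightarrow> (real^3 \<Rightarrow> 'b::euclidean_space) set" where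
  "L2_space \<Omega> = {u. u \<in> borel_measurable (lebesgue_on \<Omega>) \<and>
                    integrable (lebesgue_on \<Omega>) (\<lambda>x. (norm (u x))\<^sup>2)}"

text \<open>On \<^typ>\<open>real^3^3\<close>, \<^const>\<open>inner\<close> and \<^const>\<open>norm\<close> are the Frobenius inner product and norm.\<close>

definition L2_inner ::
    "(real^3) set \<Rightarrow> (real^3 \<Rightarrow> 'b::euclidean_space) \<Rightarrow> (real^3 \<Rightarrow> 'b) \<Rightarrow> real" where
  "L2_inner \<Omega> u v = integral\<^sup>L (lebesgue_on \<Omega>) (\<lambda>x. inner (u x) (v x))"

definition L2_norm :: "(real^3) set \<Rightarrow> (real^3 \<Rightarrow> 'b::euclidean_space) \<Rightarrow> real" where
  "L2_norm \<Omega> u = sqrt (L2_inner \<Omega> u u)"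

definition partial_deriv :: "3 \<Rightarrow> (real^3 \<Rightarrow> real) \<Rightarrow> real^3 \<Rightarrow> real" where
  "partial_deriv j \<psi> x = frechet_derivative \<psi> (at x) (axis j 1)"

fun C_times_diff :: "nat \<Rightarrow> (real^3 \<Rightarrow> real) \<Rightarrow> bool" where
  "C_times_diff 0 \<psi> \<longleftrightarrow> continuous_on UNIV \<psi>"
| "C_times_diff (Suc r) \<psi> \<longleftrightarrow>
     (\<forall>x. \<psi> differentiable (at x)) \<and> (\<forall>j. C_times_diff r (partial_deriv j \<psi>))"

definition test_functions :: "(real^3) set \<Rightarrow> (real^3 \<Rightarrow> real) set" where
  "test_functions \<Omega> = {\<psi>. (\<forall>r. C_times_diff r \<psi>) \<and>
                         compact (closure {x. \<psi> x \<noteq> 0}) \<and> closure {x. \<psi> x \<noteq> 0} \<subseteq> \<Omega>}"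

text \<open>Row \<open>i\<close> of \<open>G x\<close> is the gradient of the \<open>i\<close>-th component, as for \<^const>\<open>jacobian\<close>.\<close>

definition weak_gradient ::
    "(real^3) set \<Rightarrow> (real^3 \<Rightarrow> real^3) \<Rightarrow> (real^3 \<Rightarrow> real^3^3) \<Rightarrow> bool" where
  "weak_gradient \<Omega> u G \<longleftrightarrow>
     (\<forall>\<psi>\<in>test_functions \<Omega>. \<forall>i j.
        integral\<^sup>L (lebesgue_on \<Omega>) (\<lambda>x. u x $ i * partial_deriv j \<psi> x)
        = - integral\<^sup>L (lebesgue_on \<Omega>) (\<lambda>x. G x $ i $ j * \<psi> x))"

definition H1_space :: "(real^3) set \<Rightarrow> (real^3 \<Rightarrow> real^3) set" where
  "H1_space \<Omega> = {u \<in> L2_space \<Omega>. \<exists>G\<in>L2_space \<Omega>. weak_gradient \<Omega> u G}"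

text \<open>
  Operators act on representatives of almost-everywhere classes, hence the second clause. The last
  clause bounds the \<open>L\<^sup>2\<close>-norm by the \<open>H\<^sup>1\<close>-norm. Linearity is not required, so that bounded
  linear operators are a special case.
\<close>

definition bounded_H1_L2 ::
    "(real^3) set \<Rightarrow> ((real^3 \<Rightarrow> real^3) \<Rightarrow> (real^3 \<Rightarrow> real^3)) \<Rightarrow> bool" where
  "bounded_H1_L2 \<Omega> P \<longleftrightarrow>
     (\<forall>u\<in>H1_space \<Omega>. P u \<in> L2_space \<Omega>) \<and>
     (\<forall>u\<in>H1_space \<Omega>. \<forall>v\<in>H1_space \<Omega>.
        (AE x in lebesgue_on \<Omega>. u x = v x) \<longrightarrow> (AE x in lebesgue_on \<Omega>. P u x = P v x)) \<and>
     (\<exists>C. \<forall>u\<in>L2_space \<Omega>. \<forall>G\<in>L2_space \<Omega>. weak_gradient \<Omega> u G \<longrightarrow>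
        L2_norm \<Omega> (P u) \<le> C * sqrt ((L2_norm \<Omega> u)\<^sup>2 + (L2_norm \<Omega> G)\<^sup>2))"

definition C1_into_L2 ::
    "(real^3) set \<Rightarrow> real \<Rightarrow> (real \<Rightarrow> real^3 \<Rightarrow> real^3) \<Rightarrow> bool" where
  "C1_into_L2 \<Omega> T f \<longleftrightarrow>
     (\<forall>t\<in>{0..T}. f t \<in> L2_space \<Omega>) \<and>
     (\<exists>f'. \<forall>t\<in>{0..T}. f' t \<in> L2_space \<Omega> \<and>
        ((\<lambda>s. L2_norm \<Omega> (\<lambda>x. (f s x - f t x) /\<^sub>R (s - t) - f' t x)) \<longlongrightarrow> 0) (at t within {0..T}) \<and>
        ((\<lambda>s. L2_norm \<Omega> (\<lambda>x. f' s x - f' t x)) \<longlongrightarrow> 0) (at t within {0..T}))"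


section \<open>Domain, mesh and discrete spaces\<close>

text \<open>
  After a rotation or reflection \<open>R\<close>, the domain lies locally strictly above a Lipschitz graph.
\<close>

definition bounded_Lipschitz_domain :: "(real^3) set \<Rightarrow> bool" where
  "bounded_Lipschitz_domain \<Omega> \<longleftrightarrow>
     \<Omega> \<noteq> {} \<and> open \<Omega> \<and> connected \<Omega> \<and> bounded \<Omega> \<and>
     (\<forall>p\<in>frontier \<Omega>. \<exists>(R :: real^3 \<Rightarrow> real^3) (g :: real^2 \<Rightarrow> real) L r.
        orthogonal_transformation R \<and> lipschitz_on L UNIV g \<and> 0 < r \<and>
        \<Omega> \<inter> ball p r = {x \<in> ball p r. g (vector [R x $ 1, R x $ 2]) < R x $ 3})"

definition tetrahedral_mesh :: "(real^3) set \<Rightarrow> (real^3) set set \<Rightarrow> bool" where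
  "tetrahedral_mesh \<Omega> \<T> \<longleftrightarrow>
     triangulation \<T> \<and> (\<forall>K\<in>\<T>. 3 simplex K) \<and> \<Union>\<T> = closure \<Omega>"

definition quasi_uniform :: "(real^3) set set \<Rightarrow> real \<Rightarrow> real \<Rightarrow> bool" where
  "quasi_uniform \<T> Cmesh h \<longleftrightarrow>
     (\<forall>K\<in>\<T>. h \<le> root 3 (measure lebesgue K) \<and>
             root 3 (measure lebesgue K) \<le> diameter K \<and> diameter K \<le> Cmesh * h)"

definition nodes :: "(real^3) set set \<Rightarrow> (real^3) set" where
  "nodes \<T> = {z. \<exists>K\<in>\<T>. z extreme_point_of K}"

text \<open>
  The finite element functions are functions on \<^term>\<open>closure \<Omega>\<close>; they are extended by \<open>0\<close>, so that
  equality of total functions is equality on \<^term>\<open>closure \<Omega>\<close>.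
\<close>

definition P1_space :: "(real^3) set \<Rightarrow> (real^3) set set \<Rightarrow> (real^3 \<Rightarrow> real) set" where
  "P1_space \<Omega> \<T> =
     {u. continuous_on (closure \<Omega>) u \<and>
         (\<forall>K\<in>\<T>. \<exists>a c. \<forall>x\<in>K. u x = inner a x + c) \<and>
         (\<forall>x. x \<notin> closure \<Omega> \<longrightarrow> u x = 0)}"

definition P1_space3 :: "(real^3) set \<Rightarrow> (real^3) set set \<Rightarrow> (real^3 \<Rightarrow> real^3) set" where
  "P1_space3 \<Omega> \<T> = {u. \<forall>l. (\<lambda>x. u x $ l) \<in> P1_space \<Omega> \<T>}"

definition hat_fun :: "(real^3) set \<Rightarrow> (real^3) set set \<Rightarrow> real^3 \<Rightarrow> real^3 \<Rightarrow> real" where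
  "hat_fun \<Omega> \<T> z =
     (THE u. u \<in> P1_space \<Omega> \<T> \<and> (\<forall>y\<in>nodes \<T>. u y = (if y = z then 1 else 0)))"

definition M_space :: "(real^3) set \<Rightarrow> (real^3) set set \<Rightarrow> (real^3 \<Rightarrow> real^3) set" where
  "M_space \<Omega> \<T> = {u \<in> P1_space3 \<Omega> \<T>. \<forall>z\<in>nodes \<T>. norm (u z) = 1}"

definition K_space ::
    "(real^3) set \<Rightarrow> (real^3) set set \<Rightarrow> (real^3 \<Rightarrow> real^3) \<Rightarrow> (real^3 \<Rightarrow> real^3) set" where
  "K_space \<Omega> \<T> \<mu> = {u \<in> P1_space3 \<Omega> \<T>. \<forall>z\<in>nodes \<T>. inner (u z) (\<mu> z) = 0}"

text \<open>
  \<open>unit_vector l\<close> for \<open>l = 0, 1, 2\<close> are the three standard unit vectors, and the nodal basis has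
  index \<open>3 * j + l\<close> for node \<open>j < N\<close> and direction \<open>l < 3\<close>.
\<close>

definition unit_vector :: "nat \<Rightarrow> real^3" where
  "unit_vector l = axis (of_nat (Suc l)) 1"

definition nodal_basis ::
    "(real^3) set \<Rightarrow> (real^3) set set \<Rightarrow> (nat \<Rightarrow> real^3) \<Rightarrow> nat \<Rightarrow> real^3 \<Rightarrow> real^3" where
  "nodal_basis \<Omega> \<T> z i x = hat_fun \<Omega> \<T> (z (i div 3)) x *\<^sub>R unit_vector (i mod 3)"


section \<open>The variational formulation\<close>

text \<open>
  Finite element functions are differentiable off the faces of the mesh, a null set;
  \<^term>\<open>jacobian u (at x)\<close> is their elementwise gradient almost everywhere.
\<close>

definition lambda_h ::
    "real \<Rightarrow> (real^3 \<Rightarrow> real^3) \<Rightarrow> ((real^3 \<Rightarrow> real^3) \<Rightarrow> real^3 \<Rightarrow> real^3) \<Rightarrow>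
     (real^3 \<Rightarrow> real^3) \<Rightarrow> real^3 \<Rightarrow> real" where
  "lambda_h lx ft P m x =
     - lx\<^sup>2 * (norm (jacobian m (at x)))\<^sup>2 + inner (ft x + P m x) (m x)"

text \<open>
  In the following, \<open>w\<close> stands for the weight \<open>W\<^sub>k(\<lambda>\<^sub>h)\<close>, \<open>\<kappa>\<close> for \<open>\<beta>(k) k\<close> and \<open>q\<close> for the
  lower-order term \<open>L\<^sub>h\<close>.
\<close>

definition variational_solution ::
    "(real^3) set \<Rightarrow> (real^3) set set \<Rightarrow> real \<Rightarrow> real \<Rightarrow> (real^3 \<Rightarrow> real) \<Rightarrow>
     (real^3 \<Rightarrow> real^3) \<Rightarrow> (real^3 \<Rightarrow> real^3) \<Rightarrow> (real^3 \<Rightarrow> real^3) \<Rightarrow> bool" where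
  "variational_solution \<Omega> \<T> lx \<kappa> w q m v \<longleftrightarrow>
     v \<in> K_space \<Omega> \<T> m \<and>
     (\<forall>\<phi>\<in>K_space \<Omega> \<T> m.
        L2_inner \<Omega> (\<lambda>x. w x *\<^sub>R v x) \<phi> + L2_inner \<Omega> (\<lambda>x. cross3 (m x) (v x)) \<phi>
          + \<kappa> * L2_inner \<Omega> (\<lambda>x. jacobian v (at x)) (\<lambda>x. jacobian \<phi> (at x))
        = - lx\<^sup>2 * L2_inner \<Omega> (\<lambda>x. jacobian m (at x)) (\<lambda>x. jacobian \<phi> (at x))
          + L2_inner \<Omega> q \<phi>)"


section \<open>The linear system\<close>

definition mass_matrix ::
    "(real^3) set \<Rightarrow> nat \<Rightarrow> (nat \<Rightarrow> real^3 \<Rightarrow> real^3) \<Rightarrow> real \<Rightarrow> (real^3 \<Rightarrow> real) \<Rightarrow> real mat" where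
  "mass_matrix \<Omega> N \<phi> \<alpha> w =
     Matrix.mat (3 * N) (3 * N) (\<lambda>(i, j). L2_inner \<Omega> (\<lambda>x. (w x / \<alpha>) *\<^sub>R \<phi> i x) (\<phi> j))"

definition stiffness_matrix ::
    "(real^3) set \<Rightarrow> nat \<Rightarrow> (nat \<Rightarrow> real^3 \<Rightarrow> real^3) \<Rightarrow> real mat" where
  "stiffness_matrix \<Omega> N \<phi> =
     Matrix.mat (3 * N) (3 * N)
       (\<lambda>(i, j). L2_inner \<Omega> (\<lambda>x. jacobian (\<phi> i) (at x)) (\<lambda>x. jacobian (\<phi> j) (at x)))"

definition cross_matrix ::
    "(real^3) set \<Rightarrow> nat \<Rightarrow> (nat \<Rightarrow> real^3 \<Rightarrow> real^3) \<Rightarrow> (real^3 \<Rightarrow> real^3) \<Rightarrow> real mat" where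
  "cross_matrix \<Omega> N \<phi> m =
     Matrix.mat (3 * N) (3 * N) (\<lambda>(i, j). L2_inner \<Omega> (\<lambda>x. cross3 (m x) (\<phi> i x)) (\<phi> j))"

definition system_matrix ::
    "(real^3) set \<Rightarrow> nat \<Rightarrow> (nat \<Rightarrow> real^3 \<Rightarrow> real^3) \<Rightarrow> real \<Rightarrow> real \<Rightarrow> (real^3 \<Rightarrow> real) \<Rightarrow>
     (real^3 \<Rightarrow> real^3) \<Rightarrow> real mat" where
  "system_matrix \<Omega> N \<phi> \<alpha> \<kappa> w m =
     \<alpha> \<cdot>\<^sub>m mass_matrix \<Omega> N \<phi> \<alpha> w + \<kappa> \<cdot>\<^sub>m stiffness_matrix \<Omega> N \<phi> - cross_matrix \<Omega> N \<phi> m"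

definition load_vector ::
    "(real^3) set \<Rightarrow> nat \<Rightarrow> (nat \<Rightarrow> real^3 \<Rightarrow> real^3) \<Rightarrow> real \<Rightarrow> (real^3 \<Rightarrow> real^3) \<Rightarrow>
     (real^3 \<Rightarrow> real^3) \<Rightarrow> real Matrix.vec" where
  "load_vector \<Omega> N \<phi> lx q m =
     Matrix.vec (3 * N)
       (\<lambda>j. - lx\<^sup>2 * L2_inner \<Omega> (\<lambda>x. jacobian m (at x)) (\<lambda>x. jacobian (\<phi> j) (at x))
            + L2_inner \<Omega> q (\<phi> j))"

definition householder :: "real^3 \<Rightarrow> real^3^3" where
  "householder m =
     (let e3 = axis 3 1; w = (m + e3) /\<^sub>R norm (m + e3) in
      if m = - e3 then transpose (vector [axis 1 1, axis 2 1, - e3])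
      else (\<chi> i j. (if i = j then 1 else 0) - 2 * (w $ i * w $ j)))"

text \<open>\<^const>\<open>vector\<close> lists the rows of a matrix; the transpose has them as columns.\<close>

definition householder_tangent :: "real^3 \<Rightarrow> real^2^3" where
  "householder_tangent m =
     transpose (vector [householder m *v axis 1 1, householder m *v axis 2 1])"

definition tangent_matrix ::
    "nat \<Rightarrow> (nat \<Rightarrow> real^3) \<Rightarrow> real^3^3 \<Rightarrow> (real^3 \<Rightarrow> real^3) \<Rightarrow> real mat" where
  "tangent_matrix N z Tn m =
     diag_block_mat (map (\<lambda>i.
       let B = Tn ** householder_tangent (Tn *v m (z i)) in
       Matrix.mat 3 2 (\<lambda>(r, c). B $ of_nat (Suc r) $ of_nat (Suc c))) [0..<N])"

definition positive_definite_mat :: "real mat \<Rightarrow> bool" where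
  "positive_definite_mat A \<longleftrightarrow>
     square_mat A \<and>
     (\<forall>x\<in>carrier_vec (dim_row A). x \<noteq> 0\<^sub>v (dim_row A) \<longrightarrow> 0 < scalar_prod x (A *\<^sub>v x))"

end

theory Submission
  imports Defs "Jordan_Normal_Form.Determinant"
begin

text \<open>
  At every node the two columns of the block of \<open>Q\<close> form a basis of the plane orthogonal to
  \<open>m(z\<^sub>i)\<close>, because a Householder reflection exchanges \<open>\<plusminus>m\<close> and the third unit vector. Hence
  \<open>x \<mapsto> \<Sum>\<^sub>j (Q x)\<^sub>j \<phi>\<^sub>j\<close> is a bijection from the coefficient space onto the discrete tangent space, and
  the variational problem becomes \<open>y \<cdot> B x = y \<cdot> Q\<^sup>T b\<close> for all \<open>y\<close>. The quadratic form of \<open>B\<close> is the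
  bilinear form on the diagonal, where the cross product term vanishes, the gradient term is
  nonnegative and the weighted mass term is positive.

  The integrals are only meaningful if the weight is measurable. This requires
  \<open>P m\<close> to be an \<open>L\<^sup>2\<close> function and thus \<open>m\<close> to belong to \<open>H\<^sup>1\<close>: the product of a finite element
  function and a test function has bounded difference quotients, whose integrals vanish by
  translation invariance, and dominated convergence gives the integration by parts formula.
\<close>

text \<open>Bochner integrals are total and return 0 on non-integrable functions, so a form may be
  expanded in coefficients only after integrability has been secured. Every factor built from finite
  element functions is therefore shown to be essentially bounded on the finite measure space
  \<Omega>. For Jacobians, bounds and expansions hold only almost everywhere, because
  \<open>jacobian\<close> has an unspecified value where a function is not differentiable. The
  lower-order term is merely square integrable and is paired with bounded functions.

  Uniqueness of \<open>v\<close> is literal equality of functions on the whole space: finite element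
  functions vanish outside the closure of \<Omega>, and on it they are determined by their nodal
  values. Existence comes from linear algebra alone, since a square matrix with positive quadratic
  form has trivial kernel.\<close>

no_notation vec_index (infixl "$" 100)
no_notation scalar_prod (infix "\<bullet>" 70)

section \<open>Householder matrices and the tangent matrix\<close>

lemma householder_minus_axis3:
  "householder (- axis 3 1) = (\<chi> i j. if i = j then (if i = 3 then - 1 else 1) else 0)"
  unfolding householder_def Let_def Finite_Cartesian_Product.vec_eq_iff forall_3
  by (simp add: transpose_def vector_3 axis_def)

lemma householder_reflection:
  assumes "u \<noteq> - axis 3 1"
  shows "householder u = (\<chi> i j. (if i = j then 1 else 0)
    - 2 * (((u + axis 3 1) /\<^sub>R norm (u + axis 3 1)) $ i * ((u + axis 3 1) /\<^sub>R norm (u + axis 3 1)) $ j))"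
  using assms unfolding householder_def Let_def by simp

lemma householder_symmetric: "transpose (householder u) = householder u"
proof (cases "u = - axis 3 1")
  case True
  then show ?thesis unfolding True householder_minus_axis3 Finite_Cartesian_Product.vec_eq_iff
    by (simp add: transpose_def)
next
  case False
  then show ?thesis unfolding householder_reflection[OF False] Finite_Cartesian_Product.vec_eq_iff
    by (simp add: transpose_def mult.commute)
qed

lemma householder_reflection_mult:
  fixes u :: "real^3"
  defines "w \<equiv> (u + axis 3 1) /\<^sub>R norm (u + axis 3 1)"
  assumes "u \<noteq> - axis 3 1"
  shows "householder u *v a = a - (2 * inner w a) *\<^sub>R w"
  unfolding householder_reflection[OF assms(2), folded w_def] Finite_Cartesian_Product.vec_eq_iff forall_3
  by (simp add: matrix_vector_mult_def sum_3 inner_vec_def algebra_simps)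

lemma householder_involution:
  assumes "norm u = 1"
  shows "householder u *v (householder u *v a) = a"
proof (cases "u = - axis 3 1")
  case True
  show ?thesis unfolding True householder_minus_axis3 Finite_Cartesian_Product.vec_eq_iff forall_3
    by (simp add: matrix_vector_mult_def sum_3)
next
  case False
  define w where "w = (u + axis 3 1) /\<^sub>R norm (u + axis 3 1)"
  have "norm w = 1"
    using False by (simp add: w_def eq_neg_iff_add_eq_0)
  then have "inner w w = 1" by (simp add: norm_eq_1)
  then show ?thesis
    by (simp add: householder_reflection_mult[OF False, folded w_def] inner_diff_right)
qed

text \<open>Both vectors have length 1, so \<open>u + axis 3 1\<close> bisects them and the
  reflection along it sends the third unit vector to \<open>- u\<close>. In the exceptional case the
  matrix is diag(1, 1, -1) and the sign is the opposite one, hence the disjunction; orthogonality to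
  \<open>u\<close> does not see the sign.\<close>

lemma householder_axis3:
  assumes "norm u = 1"
  shows "householder u *v axis 3 1 = u \<or> householder u *v axis 3 1 = - u"
proof (cases "u = - axis 3 1")
  case True
  have "householder u *v axis 3 1 = u"
    unfolding True householder_minus_axis3 Finite_Cartesian_Product.vec_eq_iff forall_3
    by (simp add: axis_def matrix_vector_mult_def sum_3)
  then show ?thesis ..
next
  case False
  define c where "c = norm (u + axis 3 1)"
  have c: "c \<noteq> 0" using False by (simp add: c_def eq_neg_iff_add_eq_0)
  \<comment> \<open>As both vectors are unit vectors, the right-hand side is twice the product of
    \<open>u + axis 3 1\<close> with the third unit vector. Dividing by \<open>c\<close> gives the
    coefficient of the reflection, and subtracting \<open>u + axis 3 1\<close> from that unit vector
    leaves \<open>- u\<close>.\<close>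
  have "c^2 = inner u u + 2 * inner u (axis 3 1) + inner (axis 3 1) (axis 3 1 :: real^3)"
    by (simp only: c_def power2_norm_eq_inner inner_add_left inner_add_right inner_commute)
  also have "\<dots> = 2 * inner (u + axis 3 1) (axis 3 1)"
    using assms by (simp add: norm_eq_1 inner_add_left inner_axis_axis)
  finally have "2 * inner (u + axis 3 1) (axis 3 1) = c * c"
    by (simp add: power2_eq_square)
  then have "2 * inner ((u + axis 3 1) /\<^sub>R c) (axis 3 1) = c"
    using c by (simp add: divide_simps)
  then have "householder u *v axis 3 1 = - u"
    using c unfolding householder_reflection_mult[OF False] c_def[symmetric] by simp
  then show ?thesis ..
qed

text \<open>Padding with a zero third coordinate replaces the 3 by 2 matrix by the full reflection,
  which can be inverted.\<close>

lemma householder_tangent_eq: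
  "householder_tangent u *v y = householder u *v vector [y $ 1, y $ 2, 0]"
  unfolding householder_tangent_def Finite_Cartesian_Product.vec_eq_iff forall_3
  by (simp add: matrix_vector_mult_def transpose_def sum_3 sum_2 vector_3 vector_2 axis_def)

text \<open>The tangent plane at \<open>u\<close> is the image of the plane \<open>y\<^sub>3 = 0\<close> under the reflection, because the
  reflection maps the third unit vector to \<open>\<plusminus>u\<close>.\<close>

lemma bij_betw_householder_tangent:
  assumes u: "norm u = 1"
  shows "bij_betw (\<lambda>y. householder_tangent u *v y) UNIV {a. inner a u = 0}"
proof -
  let ?H = "householder u"
  have inv: "?H *v (?H *v a) = a" for a
    by (rule householder_involution[OF u])
  have adj: "inner (?H *v a) b = inner a (?H *v b)" for a b
    by (metis dot_lmul_matrix householder_symmetric vector_transpose_matrix transpose_matrix_vector)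
  have perp: "inner a u = 0 \<longleftrightarrow> (?H *v a) $ 3 = 0" for a
  proof -
    have "(?H *v a) $ 3 = inner a (?H *v axis 3 1)"
      by (simp add: adj[symmetric] inner_axis)
    then show ?thesis using householder_axis3[OF u] by auto
  qed
  show ?thesis
  proof (rule bij_betwI[where g = "\<lambda>a. vector [(?H *v a) $ 1, (?H *v a) $ 2]"])
    show "(\<lambda>y. householder_tangent u *v y) \<in> UNIV \<rightarrow> {a. inner a u = 0}"
      by (auto simp: perp householder_tangent_eq inv vector_3)
    show "vector [(?H *v (householder_tangent u *v y)) $ 1, (?H *v (householder_tangent u *v y)) $ 2] = y"
      for y :: "real^2"
      by (simp add: householder_tangent_eq inv Finite_Cartesian_Product.vec_eq_iff forall_2 vector_3 vector_2)
    show "householder_tangent u *v vector [(?H *v a) $ 1, (?H *v a) $ 2] = a"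
      if "a \<in> {a. inner a u = 0}" for a
    proof -
      have "vector [(?H *v a) $ 1, (?H *v a) $ 2, 0] = ?H *v a"
        using that by (simp add: Finite_Cartesian_Product.vec_eq_iff forall_3 vector_3 perp)
      then show ?thesis by (simp add: householder_tangent_eq vector_2 inv)
    qed
  qed auto
qed

text \<open>A symmetric involution is orthogonal, so \<open>Tn\<close> preserves the length of
  \<open>u\<close> and carries the plane orthogonal to \<open>Tn *v u\<close> onto the plane
  orthogonal to \<open>u\<close>.\<close>

lemma bij_betw_rotated_householder_tangent:
  fixes Tn :: "real^3^3"
  assumes inv: "Tn ** Tn = Finite_Cartesian_Product.mat 1" and sym: "transpose Tn = Tn" and u: "norm u = 1"
  shows "bij_betw (\<lambda>y. (Tn ** householder_tangent (Tn *v u)) *v y) UNIV {a. inner a u = 0}"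
proof -
  have adj: "inner (Tn *v a) b = inner a (Tn *v b)" for a b
    by (metis dot_lmul_matrix sym vector_transpose_matrix transpose_matrix_vector)
  have TT: "Tn *v (Tn *v a) = a" for a
    by (simp add: matrix_vector_mul_assoc inv)
  have "norm (Tn *v u) = 1"
    using u by (simp add: norm_eq_1 adj TT)
  then have 1: "bij_betw (\<lambda>y. householder_tangent (Tn *v u) *v y) UNIV {a. inner a (Tn *v u) = 0}"
    by (rule bij_betw_householder_tangent)
  have 2: "bij_betw ((*v) Tn) {a. inner a (Tn *v u) = 0} {a. inner a u = 0}"
    by (rule bij_betwI[where g = "(*v) Tn"]) (auto simp: adj TT)
  show ?thesis
    using bij_betw_trans[OF 1 2] by (simp add: o_def matrix_vector_mul_assoc)
qed

text \<open>With blocks of one size, quotient and remainder of an index give the block and the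
  position inside it. In the induction, passing to the tail shifts the indices by \<open>p\<close>
  and \<open>q\<close>, which lowers both quotients by one.\<close>

lemma diag_block_mat_uniform:
  assumes "\<And>B. B \<in> set Bs \<Longrightarrow> B \<in> carrier_mat p q"
  shows "diag_block_mat Bs \<in> carrier_mat (p * length Bs) (q * length Bs)"
    and "\<And>i j. i < p * length Bs \<Longrightarrow> j < q * length Bs \<Longrightarrow>
      diag_block_mat Bs $$ (i, j) =
        (if i div p = j div q then (Bs ! (i div p)) $$ (i mod p, j mod q) else 0)"
proof -
  have *: "diag_block_mat Bs \<in> carrier_mat (p * length Bs) (q * length Bs) \<and>
     (\<forall>i j. i < p * length Bs \<longrightarrow> j < q * length Bs \<longrightarrow>
      diag_block_mat Bs $$ (i, j) =
        (if i div p = j div q then (Bs ! (i div p)) $$ (i mod p, j mod q) else 0))"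
    using assms
  proof (induction Bs)
    case Nil
    then show ?case by simp
  next
    case (Cons B Bs)
    have "B \<in> carrier_mat p q" by (rule Cons.prems) (rule list.set_intros(1))
    note B = carrier_matD[OF this]
    have "diag_block_mat Bs \<in> carrier_mat (p * length Bs) (q * length Bs) \<and>
     (\<forall>i j. i < p * length Bs \<longrightarrow> j < q * length Bs \<longrightarrow>
      diag_block_mat Bs $$ (i, j) =
        (if i div p = j div q then (Bs ! (i div p)) $$ (i mod p, j mod q) else 0))"
      by (rule Cons.IH) (rule Cons.prems, erule list.set_intros(2))
    note IH = this
    note D = IH[THEN conjunct1] and ent = IH[THEN conjunct2, rule_format]
    define R where "R = p * length Bs"
    define C where "C = q * length Bs"
    have dimR: "dim_row (diag_block_mat Bs) = R" unfolding R_def using D by (rule carrier_matD)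
    have dimC: "dim_col (diag_block_mat Bs) = C" unfolding C_def using D by (rule carrier_matD)
    have len: "p * length (B # Bs) = p + R" "q * length (B # Bs) = q + C"
      unfolding R_def C_def length_Cons mult_Suc_right by (rule refl)+
    have "diag_block_mat (B # Bs) $$ (i, j) =
        (if i div p = j div q then ((B # Bs) ! (i div p)) $$ (i mod p, j mod q) else 0)"
      if "i < p * length (B # Bs)" and "j < q * length (B # Bs)" for i j
    proof -
      have i: "i < p + R" and j: "j < q + C" using that unfolding len .
      have "p \<noteq> 0" "q \<noteq> 0" using that by (metis mult_0 not_less_zero)+
      then have pq: "0 < p" "0 < q" by simp_all
      have entry: "diag_block_mat (B # Bs) $$ (i, j) =
        (if i < p then if j < q then B $$ (i, j) else 0\<^sub>m p C $$ (i, j - q)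
         else if j < q then 0\<^sub>m R q $$ (i - p, j) else diag_block_mat Bs $$ (i - p, j - q))"
        using i j unfolding diag_block_mat.simps Let_def
        by (subst index_mat_four_block) (simp_all only: B dimR dimC)
      show ?thesis
      proof (cases "i < p"; cases "j < q")
        assume "i < p" "j < q"
        then show ?thesis unfolding entry by simp
      next
        assume ij: "i < p" "\<not> j < q"
        then have "j - q < C" "j div q \<noteq> 0" using j pq by (simp_all add: div_eq_0_iff)
        then show ?thesis unfolding entry using ij by simp
      next
        assume ij: "\<not> i < p" "j < q"
        then have "i - p < R" "i div p \<noteq> 0" using i pq by (simp_all add: div_eq_0_iff)
        then show ?thesis unfolding entry using ij by simp
      next
        assume ij: "\<not> i < p" "\<not> j < q"
        define i' j' where "i' = i - p" and "j' = j - q"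
        have eq: "i = p + i'" "j = q + j'" using ij by (simp_all add: i'_def j'_def)
        have lt: "i' < p * length Bs" "j' < q * length Bs"
          using i j ij unfolding R_def[symmetric] C_def[symmetric] i'_def j'_def by linarith+
        show ?thesis unfolding entry unfolding eq using pq by (simp add: ent[OF lt])
      qed
    qed
    moreover have "diag_block_mat (B # Bs) \<in> carrier_mat (p * length (B # Bs)) (q * length (B # Bs))"
      unfolding len diag_block_mat.simps Let_def
      by (intro carrier_matI) (simp_all only: index_mat_four_block B dimR dimC)
    ultimately show ?case by blast
  qed
  from * show "diag_block_mat Bs \<in> carrier_mat (p * length Bs) (q * length Bs)"
    by (rule conjunct1)
  fix i j
  assume "i < p * length Bs" "j < q * length Bs"
  with * show "diag_block_mat Bs $$ (i, j) =
        (if i div p = j div q then (Bs ! (i div p)) $$ (i mod p, j mod q) else 0)"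
    by simp
qed

text \<open>A nonzero kernel vector would make the quadratic form vanish.\<close>

lemma positive_definite_mat_invertible:
  assumes B: "B \<in> carrier_mat n n" and pos: "positive_definite_mat B"
  shows "invertible_mat B"
proof -
  have "\<not> (\<exists>v. v \<in> carrier_vec n \<and> v \<noteq> 0\<^sub>v n \<and> B *\<^sub>v v = 0\<^sub>v n)"
    using pos B unfolding positive_definite_mat_def by fastforce
  then have "Determinant.det B \<noteq> 0" by (simp add: det_0_iff_vec_prod_zero[OF B])
  then have "B \<in> Units (ring_mat TYPE(real) n ())" by (rule det_non_zero_imp_unit[OF B])
  then obtain C where "C \<in> carrier_mat n n" "B * C = 1\<^sub>m n" "C * B = 1\<^sub>m n"
    unfolding Units_def ring_mat_def by auto
  with B show ?thesis unfolding invertible_mat_def inverts_mat_def by auto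
qed

lemma invertible_mat_unique_solution:
  fixes B :: "'a::comm_ring_1 mat"
  assumes B: "B \<in> carrier_mat n n" and inv: "invertible_mat B" and c: "c \<in> carrier_vec n"
  shows "\<exists>!x. x \<in> carrier_vec n \<and> B *\<^sub>v x = c"
proof -
  obtain C where C: "B * C = 1\<^sub>m n" "C * B = 1\<^sub>m (dim_row C)" 
    using inv B unfolding invertible_mat_def inverts_mat_def by auto
  \<comment> \<open>\<open>invertible_mat\<close> provides an inverse without stating its size; the
    sizes of the two products determine it.\<close>
  have C': "C \<in> carrier_mat n n"
    using B C by (metis carrier_matD carrier_matI index_mult_mat(2,3) index_one_mat(2,3))
  have CB: "C * B = 1\<^sub>m n" using C(2) C' by auto
  show ?thesis
  proof (rule ex1I[where a = "C *\<^sub>v c"])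
    show "C *\<^sub>v c \<in> carrier_vec n \<and> B *\<^sub>v (C *\<^sub>v c) = c"
      using assoc_mult_mat_vec[OF B C' c] C' c C(1) by auto
    show "x = C *\<^sub>v c" if "x \<in> carrier_vec n \<and> B *\<^sub>v x = c" for x
      using that assoc_mult_mat_vec[OF C' B, of x] CB by auto
  qed
qed

text \<open>Three consecutive coefficients are read as a vector of \<open>real^3\<close>, so that
  conditions at a node become geometric conditions on one vector.\<close>

definition node_value :: "real Matrix.vec \<Rightarrow> nat \<Rightarrow> real^3" where
  "node_value c i = (\<Sum>l<3. vec_index c (3 * i + l) *\<^sub>R unit_vector l)"

lemma unit_vector_simps:
  "unit_vector 0 = axis 1 1" "unit_vector (Suc 0) = axis 2 1" "unit_vector 2 = axis 3 1"
  by (simp_all add: unit_vector_def)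

lemma node_value_nth:
  "node_value c i $ 1 = vec_index c (3 * i)" "node_value c i $ 2 = vec_index c (3 * i + 1)"
  "node_value c i $ 3 = vec_index c (3 * i + 2)"
  by (simp_all add: node_value_def numeral_3_eq_3 lessThan_Suc unit_vector_simps[unfolded numeral_2_eq_2] axis_def)

lemma sum_nodal_basis:
  "(\<Sum>j<3 * N. vec_index c j *\<^sub>R nodal_basis \<Omega> \<T> z j y)
    = (\<Sum>i<N. hat_fun \<Omega> \<T> (z i) y *\<^sub>R node_value c i)"
proof -
  have "(\<Sum>j<3 * N. vec_index c j *\<^sub>R nodal_basis \<Omega> \<T> z j y)
      = (\<Sum>i<N. \<Sum>j = i * 3..<i * 3 + 3. vec_index c j *\<^sub>R nodal_basis \<Omega> \<T> z j y)"
    using sum.nat_group[of "\<lambda>j. vec_index c j *\<^sub>R nodal_basis \<Omega> \<T> z j y" 3 N] by (simp add: mult.commute)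
  also have "\<dots> = (\<Sum>i<N. \<Sum>l<3. vec_index c (3 * i + l) *\<^sub>R nodal_basis \<Omega> \<T> z (3 * i + l) y)"
  proof (rule sum.cong[OF refl])
    fix i :: nat
    have *: "{i * 3..<i * 3 + 3} = {3 * i, 3 * i + 1, 3 * i + 2}" by auto
    show "(\<Sum>j = i * 3..<i * 3 + 3. vec_index c j *\<^sub>R nodal_basis \<Omega> \<T> z j y)
        = (\<Sum>l<3. vec_index c (3 * i + l) *\<^sub>R nodal_basis \<Omega> \<T> z (3 * i + l) y)"
      unfolding * by (simp add: numeral_3_eq_3 lessThan_Suc)
  qed
  also have "\<dots> = (\<Sum>i<N. hat_fun \<Omega> \<T> (z i) y *\<^sub>R node_value c i)"
    by (rule sum.cong) (simp_all add: node_value_def nodal_basis_def scaleR_sum_right mult.commute)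
  finally show ?thesis .
qed

lemma tangent_matrix_carrier: "tangent_matrix N z Tn m \<in> carrier_mat (3 * N) (2 * N)"
  unfolding tangent_matrix_def Let_def
  by (rule diag_block_mat_uniform(1)[of _ 3 2, where Bs = "map _ [0..<N]", simplified]) auto

text \<open>In the rows of node \<open>i\<close> only the columns \<open>s\<close> with
  \<open>s div 2 = i\<close> carry nonzero blocks, namely \<open>2 * i\<close> and
  \<open>2 * i + 1\<close>; the large product reduces to the local 3 by 2 block.\<close>

lemma node_value_tangent_matrix:
  assumes x: "x \<in> carrier_vec (2 * N)" and i: "i < N"
  shows "node_value (tangent_matrix N z Tn m *\<^sub>v x) i =
    (Tn ** householder_tangent (Tn *v m (z i))) *v vector [vec_index x (2 * i), vec_index x (2 * i + 1)]"
proof -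
  define B where "B = (\<lambda>i. Tn ** householder_tangent (Tn *v m (z i)))"
  have ent: "tangent_matrix N z Tn m $$ (r, s) =
      (if r div 3 = s div 2 then B (r div 3) $ of_nat (Suc (r mod 3)) $ of_nat (Suc (s mod 2)) else 0)"
    if "r < 3 * N" "s < 2 * N" for r s
    unfolding tangent_matrix_def Let_def
    using that by (subst diag_block_mat_uniform(2)[of _ 3 2]) (auto simp: B_def)
  have "vec_index (tangent_matrix N z Tn m *\<^sub>v x) (3 * i + l)
      = B i $ of_nat (Suc l) $ 1 * vec_index x (2 * i) + B i $ of_nat (Suc l) $ 2 * vec_index x (2 * i + 1)"
    if l: "l < 3" for l
  proof -
    have r: "3 * i + l < 3 * N" using i l by linarith
    have "vec_index (tangent_matrix N z Tn m *\<^sub>v x) (3 * i + l)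
        = (\<Sum>s<2 * N. tangent_matrix N z Tn m $$ (3 * i + l, s) * vec_index x s)"
      using r x tangent_matrix_carrier[of N z Tn m] by (simp add: scalar_prod_def atLeast0LessThan)
    also have "\<dots> = (\<Sum>s<2 * N. if s \<in> {2 * i, 2 * i + 1} then B i $ of_nat (Suc l) $ of_nat (Suc (s mod 2)) * vec_index x s else 0)"
    proof (rule sum.cong[OF refl])
      fix s assume "s \<in> {..<2 * N}"
      then have s: "s < 2 * N" by simp
      have "i = s div 2 \<longleftrightarrow> s \<in> {2 * i, 2 * i + 1}" by auto
      then show "tangent_matrix N z Tn m $$ (3 * i + l, s) * vec_index x s =
        (if s \<in> {2 * i, 2 * i + 1} then B i $ of_nat (Suc l) $ of_nat (Suc (s mod 2)) * vec_index x s else 0)"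
        using l by (simp add: ent[OF r s])
    qed
    also have "\<dots> = (\<Sum>s\<in>{2 * i, 2 * i + 1}. B i $ of_nat (Suc l) $ of_nat (Suc (s mod 2)) * vec_index x s)"
      using i by (intro sum.mono_neutral_cong_right) auto
    finally show ?thesis by simp
  qed
  note * = this[of 0] this[of 1] this[of 2]
  have "(B i *v vector [a, b]) $ k = B i $ k $ 1 * a + B i $ k $ 2 * b" for a b k
    by (simp add: matrix_vector_mult_def sum_2 vector_2)
  with * have "node_value (tangent_matrix N z Tn m *\<^sub>v x) i = B i *v vector [vec_index x (2 * i), vec_index x (2 * i + 1)]"
    unfolding Finite_Cartesian_Product.vec_eq_iff forall_3 node_value_nth by simp
  then show ?thesis unfolding B_def .
qed

text \<open>Everything decouples over the nodes: two consecutive entries of \<open>x\<close> are the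
  local coordinates of the tangent vector at one node, and the bijections of the separate nodes are
  put together.\<close>

lemma
  fixes Tn :: "real^3^3"
  assumes Tn: "Tn ** Tn = Finite_Cartesian_Product.mat 1" "transpose Tn = Tn"
    and m: "\<And>i. i < N \<Longrightarrow> norm (m (z i)) = 1"
  shows node_value_tangent: "\<lbrakk>x \<in> carrier_vec (2 * N); i < N\<rbrakk> \<Longrightarrow>
      inner (node_value (tangent_matrix N z Tn m *\<^sub>v x) i) (m (z i)) = 0"
    and ex1_tangent_coefficients: "(\<And>i. i < N \<Longrightarrow> inner (a i) (m (z i)) = 0) \<Longrightarrow>
      \<exists>!x. x \<in> carrier_vec (2 * N) \<and> (\<forall>i<N. node_value (tangent_matrix N z Tn m *\<^sub>v x) i = a i)"
proof -
  define B where "B = (\<lambda>i. Tn ** householder_tangent (Tn *v m (z i)))"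
  define y :: "real Matrix.vec \<Rightarrow> nat \<Rightarrow> real^2"
    where "y x i = vector [vec_index x (2 * i), vec_index x (2 * i + 1)]" for x i
  have bij: "bij_betw (\<lambda>y. B i *v y) UNIV {a. inner a (m (z i)) = 0}" if "i < N" for i
    unfolding B_def using Tn m[OF that] by (rule bij_betw_rotated_householder_tangent)
  have Q: "node_value (tangent_matrix N z Tn m *\<^sub>v x) i = B i *v y x i"
    if "x \<in> carrier_vec (2 * N)" "i < N" for x i
    unfolding B_def y_def by (rule node_value_tangent_matrix[OF that])
  show "inner (node_value (tangent_matrix N z Tn m *\<^sub>v x) i) (m (z i)) = 0"
    if "x \<in> carrier_vec (2 * N)" "i < N"
    using bij_betwE[OF bij[OF that(2)]] Q[OF that] by simp
  assume a: "\<And>i. i < N \<Longrightarrow> inner (a i) (m (z i)) = 0"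
  define c where "c i = inv_into UNIV (\<lambda>y. B i *v y) (a i)" for i
  have c: "B i *v b = a i \<longleftrightarrow> b = c i" if "i < N" for i b
  proof -
    have "a i \<in> range (\<lambda>y. B i *v y)" "inj (\<lambda>y. B i *v y)"
      using bij[OF that] a[OF that] by (auto simp: bij_betw_def)
    then show ?thesis unfolding c_def by (metis f_inv_into_f inv_f_f)
  qed
  have split: "\<exists>i<N. s = 2 * i \<or> s = 2 * i + 1" if "s < 2 * N" for s
    using that by (intro exI[of _ "s div 2"]) auto
  show "\<exists>!x. x \<in> carrier_vec (2 * N) \<and> (\<forall>i<N. node_value (tangent_matrix N z Tn m *\<^sub>v x) i = a i)"
  proof (rule ex1I)
    \<comment> \<open>Coordinate \<open>s mod 2\<close> at node \<open>s div 2\<close>. The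
      \<open>Suc\<close> passes from indices counted from 0 to the numerals 1 and 2 of the finite
      index type.\<close>
    let ?x = "Matrix.vec (2 * N) (\<lambda>s. c (s div 2) $ of_nat (Suc (s mod 2)))"
    have "y ?x i = c i" if "i < N" for i
      using that unfolding y_def Finite_Cartesian_Product.vec_eq_iff forall_2 by (simp add: vector_2)
    then show "?x \<in> carrier_vec (2 * N) \<and> (\<forall>i<N. node_value (tangent_matrix N z Tn m *\<^sub>v ?x) i = a i)"
      by (simp add: Q c)
    fix x
    assume x: "x \<in> carrier_vec (2 * N) \<and> (\<forall>i<N. node_value (tangent_matrix N z Tn m *\<^sub>v x) i = a i)"
    then have "y x i = c i" if "i < N" for i
      using that c[OF that] Q by metis
    then have "c i $ 1 = vec_index x (2 * i)" "c i $ 2 = vec_index x (2 * i + 1)" if "i < N" for i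
      using that unfolding y_def by (metis vector_2)+
    then have "vec_index ?x s = vec_index x s" if "s < 2 * N" for s
      using split[OF that] that by auto
    with x show "x = ?x" by (intro eq_vecI) auto
  qed
qed

section \<open>Finite element functions on a tetrahedral mesh\<close>

text \<open>After translating one point \<open>p\<close> to the origin the remaining points are
  linearly independent, so a linear functional takes prescribed values on them. It is the inner
  product with \<open>adjoint f 1\<close>, and the constant is chosen to match at
  \<open>p\<close>.\<close>

lemma affine_interpolation:
  fixes C :: "'a::euclidean_space set" and g :: "'a \<Rightarrow> real"
  assumes "\<not> affine_dependent C"
  shows "\<exists>a c. \<forall>x\<in>C. inner a x + c = g x"
proof (cases "C = {}")
  case False
  then obtain p where p: "p \<in> C" by blast
  define S where "S = C - {p}"
  have C: "C = insert p S" "p \<notin> S" using p by (auto simp: S_def)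
  have "independent ((\<lambda>x. - p + x) ` S)"
    using assms C affine_dependent_iff_dependent[of p S] by simp
  then obtain f where f: "linear f" "\<And>y. y \<in> (\<lambda>x. - p + x) ` S \<Longrightarrow> f y = g (p + y) - g p"
    using linear_independent_extend[of "(\<lambda>x. - p + x) ` S" "\<lambda>y. g (p + y) - g p"] by blast
  have fa: "f y = inner (adjoint f 1) y" for y
    using adjoint_works[OF f(1), of y 1] by (simp add: inner_commute)
  have "inner (adjoint f 1) x + (g p - inner (adjoint f 1) p) = g x" if "x \<in> C" for x
  proof (cases "x = p")
    case False
    then have "f (- p + x) = g x - g p" using that C f(2)[of "- p + x"] by auto
    then show ?thesis by (simp add: fa inner_diff_right)
  qed simp
  then show ?thesis by blast
qed simp

text \<open>The set of agreement is given by one linear equation and hence is convex.\<close>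

lemma affine_eq_on_convex_hull:
  fixes a a' :: "'a::real_inner"
  assumes "\<And>x. x \<in> C \<Longrightarrow> inner a x + c = inner a' x + c'" and "x \<in> convex hull C"
  shows "inner a x + c = inner a' x + c'"
proof -
  have "{x. inner a x + c = inner a' x + c'} = {x. inner (a - a') x = c' - c}"
    by (auto simp: inner_diff_left)
  then have "convex {x. inner a x + c = inner a' x + c'}"
    by (simp add: convex_hyperplane)
  then have "convex hull C \<subseteq> {x. inner a x + c = inner a' x + c'}"
    using assms(1) by (intro hull_minimal) auto
  then show ?thesis using assms(2) by blast
qed

section \<open>Nodal interpolation by piecewise affine functions\<close>

locale tet_mesh =
  fixes \<Omega> :: "(real^3) set" and \<T> :: "(real^3) set set"
  assumes open_domain: "open \<Omega>" and bounded_domain: "bounded \<Omega>"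
    and mesh: "tetrahedral_mesh \<Omega> \<T>"
begin

lemma finite_mesh: "finite \<T>" and mesh_cover: "\<Union>\<T> = closure \<Omega>"
  using mesh by (auto simp: tetrahedral_mesh_def triangulation_def)

lemma element_compact: "K \<in> \<T> \<Longrightarrow> compact K"
  and element_convex: "K \<in> \<T> \<Longrightarrow> convex K"
  and element_subset: "K \<in> \<T> \<Longrightarrow> K \<subseteq> closure \<Omega>"
  using mesh by (auto simp: tetrahedral_mesh_def intro: compact_simplex convex_simplex)

lemma domain_subset: "\<Omega> \<subseteq> \<Union>\<T>"
  using closure_subset mesh_cover by blast

lemma element_vertices:
  assumes "K \<in> \<T>"
  obtains C where "\<not> affine_dependent C" "K = convex hull C" "C = {p. p extreme_point_of K}" "C \<subseteq> nodes \<T>"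
proof -
  obtain C where C: "\<not> affine_dependent C" "K = convex hull C"
    using mesh assms by (auto simp: tetrahedral_mesh_def simplex_def)
  then have "C = {p. p extreme_point_of K}"
    by (simp add: extreme_point_of_convex_hull_affine_independent)
  moreover from this have "C \<subseteq> nodes \<T>" using assms by (auto simp: nodes_def)
  ultimately show thesis using that C by blast
qed

text \<open>Conformity of the mesh in the form that gluing needs: the intersection is a face of both
  elements, a face of a simplex is spanned by some of its vertices, and extreme points of a face are
  extreme in the element. Disjoint elements are covered by the empty set.\<close>

lemma element_Int:
  assumes "K \<in> \<T>" "K' \<in> \<T>"
  obtains C where "K \<inter> K' = convex hull C" "C \<subseteq> {p. p extreme_point_of K}" "C \<subseteq> {p. p extreme_point_of K'}"
proof -
  have face: "(K \<inter> K') face_of K" "(K \<inter> K') face_of K'"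
    using mesh assms by (auto simp: tetrahedral_mesh_def triangulation_def) (metis Int_commute)
  obtain V where V: "\<not> affine_dependent V" "K = convex hull V" by (rule element_vertices[OF assms(1)])
  obtain C where C: "C \<subseteq> V" "K \<inter> K' = convex hull C"
    using face(1) face_of_convex_hull_affine_independent[OF V(1)] V(2) by auto
  then have "C = {p. p extreme_point_of (K \<inter> K')}"
    using V(1) affine_independent_subset by (metis extreme_point_of_convex_hull_affine_independent mem_Collect_eq subsetI subset_antisym)
  then have "C \<subseteq> {p. p extreme_point_of K}" "C \<subseteq> {p. p extreme_point_of K'}"
    using extreme_point_of_face[OF face(1)] extreme_point_of_face[OF face(2)] by auto
  with C show thesis using that by blast
qed

text \<open>On an element, two affine functions with equal values at the vertices agree; outside the
  closure of \<Omega> both functions are zero.\<close>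

lemma P1_eqI:
  assumes u: "u \<in> P1_space \<Omega> \<T>" and v: "v \<in> P1_space \<Omega> \<T>"
    and eq: "\<And>p. p \<in> nodes \<T> \<Longrightarrow> u p = v p"
  shows "u = v"
proof
  fix x
  show "u x = v x"
  proof (cases "x \<in> closure \<Omega>")
    case True
    then obtain K where K: "K \<in> \<T>" "x \<in> K" using mesh_cover by blast
    obtain a c where u': "\<And>x. x \<in> K \<Longrightarrow> u x = inner a x + c"
      using u K(1) by (auto simp: P1_space_def)
    obtain a' c' where v': "\<And>x. x \<in> K \<Longrightarrow> v x = inner a' x + c'"
      using v K(1) by (auto simp: P1_space_def)
    obtain C where C: "K = convex hull C" "C \<subseteq> nodes \<T>"
      by (rule element_vertices[OF K(1)])
    have "inner a p + c = inner a' p + c'" if "p \<in> C" for p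
      using that C u' v' eq hull_inc[OF that, of convex] by (metis subsetD)
    then have "inner a x + c = inner a' x + c'"
      using K(2) unfolding C(1) by (rule affine_eq_on_convex_hull)
    then show ?thesis using u' v' K(2) by simp
  qed (use u v in \<open>simp add: P1_space_def\<close>)
qed

text \<open>Interpolation is done separately on each element. On the intersection of two elements
  the pieces agree at the common vertices, hence everywhere there, and pasting over a finite closed
  cover gives continuity.\<close>

lemma P1_interpolation: "\<exists>u\<in>P1_space \<Omega> \<T>. \<forall>p\<in>nodes \<T>. u p = g p"
proof -
  have "\<exists>a c. \<forall>p. p extreme_point_of K \<longrightarrow> inner a p + c = g p" if "K \<in> \<T>" for K
    using element_vertices[OF that] affine_interpolation by (metis mem_Collect_eq)
  then obtain a c where ac: "\<And>K p. K \<in> \<T> \<Longrightarrow> p extreme_point_of K \<Longrightarrow> inner (a K) p + c K = g p"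
    by metis
  \<comment> \<open>An arbitrary element containing \<open>x\<close>; the fact \<open>u\<close>
    below shows that the value does not depend on this choice.\<close>
  define E where "E x = (SOME K. K \<in> \<T> \<and> x \<in> K)" for x
  have E: "E x \<in> \<T> \<and> x \<in> E x" if "x \<in> closure \<Omega>" for x
    unfolding E_def by (rule someI_ex) (use that mesh_cover in blast)
  define u where "u x = (if x \<in> closure \<Omega> then inner (a (E x)) x + c (E x) else 0)" for x
  have u: "u x = inner (a K) x + c K" if K: "K \<in> \<T>" "x \<in> K" for K x
  proof -
    have x: "x \<in> closure \<Omega>" using K mesh_cover by blast
    obtain C where C: "E x \<inter> K = convex hull C"
        "C \<subseteq> {p. p extreme_point_of E x}" "C \<subseteq> {p. p extreme_point_of K}"
      by (rule element_Int[OF conjunct1[OF E[OF x]] K(1)])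
    have "inner (a (E x)) x + c (E x) = inner (a K) x + c K"
    proof (rule affine_eq_on_convex_hull)
      show "x \<in> convex hull C" using E[OF x] K C(1) by blast
      show "inner (a (E x)) p + c (E x) = inner (a K) p + c K" if "p \<in> C" for p
      proof -
        have "p extreme_point_of E x" "p extreme_point_of K" using that C by blast+
        then show ?thesis using ac E[OF x] K by simp
      qed
    qed
    then show ?thesis using x by (simp add: u_def)
  qed
  have "continuous_on (\<Union>K\<in>\<T>. K) u"
  proof (rule continuous_on_closed_Union)
    show "continuous_on K u" if "K \<in> \<T>" for K
      using u[OF that] by (subst continuous_on_cong[OF refl]) (auto intro!: continuous_intros)
  qed (auto simp: finite_mesh compact_imp_closed element_compact)
  then have "u \<in> P1_space \<Omega> \<T>"
    using u mesh_cover by (auto simp: P1_space_def u_def)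
  moreover have "u p = g p" if "p \<in> nodes \<T>" for p
    using that u ac by (auto simp: nodes_def extreme_point_of_def)
  ultimately show ?thesis by blast
qed

text \<open>\<open>hat_fun\<close> is a definite description, so its properties become available
  only once existence and uniqueness are known.\<close>

lemma
  assumes "p \<in> nodes \<T>"
  shows hat_fun_P1: "hat_fun \<Omega> \<T> p \<in> P1_space \<Omega> \<T>"
    and hat_fun_node: "q \<in> nodes \<T> \<Longrightarrow> hat_fun \<Omega> \<T> p q = (if q = p then 1 else 0)"
proof -
  obtain u where u: "u \<in> P1_space \<Omega> \<T>" "\<And>y. y \<in> nodes \<T> \<Longrightarrow> u y = (if y = p then 1 else 0)"
    using P1_interpolation[of "\<lambda>y. if y = p then 1 else 0"] by blast
  then have "\<exists>!u. u \<in> P1_space \<Omega> \<T> \<and> (\<forall>y\<in>nodes \<T>. u y = (if y = p then 1 else 0))"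
    by (intro ex1I[of _ u] conjI ballI P1_eqI[of _ u]) simp_all
  from theI'[OF this] show "hat_fun \<Omega> \<T> p \<in> P1_space \<Omega> \<T>"
    and "q \<in> nodes \<T> \<Longrightarrow> hat_fun \<Omega> \<T> p q = (if q = p then 1 else 0)"
    unfolding hat_fun_def by auto
qed

lemma P1_scale: "u \<in> P1_space \<Omega> \<T> \<Longrightarrow> (\<lambda>x. r * u x) \<in> P1_space \<Omega> \<T>"
proof -
  assume u: "u \<in> P1_space \<Omega> \<T>"
  have "\<exists>a c. \<forall>x\<in>K. r * u x = inner a x + c" if K: "K \<in> \<T>" for K
  proof -
    obtain a c where "\<And>x. x \<in> K \<Longrightarrow> u x = inner a x + c" using u K by (auto simp: P1_space_def)
    then show ?thesis
      by (intro exI[of _ "r *\<^sub>R a"] exI[of _ "r * c"]) (auto simp: algebra_simps)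
  qed
  with u show ?thesis by (auto simp: P1_space_def intro!: continuous_intros)
qed

lemma P1_add:
  assumes u: "u \<in> P1_space \<Omega> \<T>" and v: "v \<in> P1_space \<Omega> \<T>"
  shows "(\<lambda>x. u x + v x) \<in> P1_space \<Omega> \<T>"
proof -
  have "\<exists>a c. \<forall>x\<in>K. u x + v x = inner a x + c" if K: "K \<in> \<T>" for K
  proof -
    obtain a c where "\<And>x. x \<in> K \<Longrightarrow> u x = inner a x + c" using u K by (auto simp: P1_space_def)
    moreover obtain a' c' where "\<And>x. x \<in> K \<Longrightarrow> v x = inner a' x + c'" using v K by (auto simp: P1_space_def)
    ultimately show ?thesis
      by (intro exI[of _ "a + a'"] exI[of _ "c + c'"]) (auto simp: algebra_simps)
  qed
  with u v show ?thesis by (auto simp: P1_space_def intro!: continuous_intros)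
qed

lemma P1_zero: "(\<lambda>x. 0) \<in> P1_space \<Omega> \<T>"
  by (auto simp: P1_space_def intro!: exI[of _ 0])

lemma P1_sum: "finite I \<Longrightarrow> (\<And>i. i \<in> I \<Longrightarrow> f i \<in> P1_space \<Omega> \<T>) \<Longrightarrow> (\<lambda>x. \<Sum>i\<in>I. f i x) \<in> P1_space \<Omega> \<T>"
  by (induction I rule: finite_induct) (auto intro: P1_add P1_zero)

lemma P1_bounded:
  assumes "u \<in> P1_space \<Omega> \<T>"
  obtains B where "\<And>x. \<bar>u x\<bar> \<le> B"
proof -
  have "compact (closure \<Omega>)" using bounded_domain by simp
  then have "compact (u ` closure \<Omega>)"
    using assms by (intro compact_continuous_image) (auto simp: P1_space_def)
  then obtain B where B: "\<And>x. x \<in> closure \<Omega> \<Longrightarrow> \<bar>u x\<bar> \<le> B"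
    by (metis bounded_iff compact_imp_bounded imageI real_norm_def)
  \<comment> \<open>The maximum covers the zero extension; if the closure is empty, \<open>B\<close>
    is unconstrained and may be negative.\<close>
  have "\<bar>u x\<bar> \<le> max B 0" for x
    using B[of x] assms by (cases "x \<in> closure \<Omega>") (auto simp: P1_space_def)
  then show thesis by (rule that)
qed

end

text \<open>A class containing continuous functions on the compact closure as well as Jacobians,
  which are controlled only off a null set. It is closed under products, and on a finite measure
  space its members are integrable.\<close>

definition ess_bounded :: "'a measure \<Rightarrow> ('a \<Rightarrow> 'b::euclidean_space) \<Rightarrow> bool" where
  "ess_bounded M f \<longleftrightarrow> f \<in> borel_measurable M \<and> (\<exists>B. AE x in M. norm (f x) \<le> B)"

lemma ess_boundedI: "f \<in> borel_measurable M \<Longrightarrow> (AE x in M. norm (f x) \<le> B) \<Longrightarrow> ess_bounded M f"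
  by (auto simp: ess_bounded_def)

lemma ess_bounded_scaleR:
  fixes f :: "'a \<Rightarrow> real" and g :: "'a \<Rightarrow> 'b::euclidean_space"
  assumes "ess_bounded M f" "ess_bounded M g"
  shows "ess_bounded M (\<lambda>x. f x *\<^sub>R g x)"
proof -
  obtain B C where B: "AE x in M. norm (f x) \<le> B" and C: "AE x in M. norm (g x) \<le> C"
    using assms by (auto simp: ess_bounded_def)
  have "AE x in M. norm (f x *\<^sub>R g x) \<le> \<bar>B\<bar> * \<bar>C\<bar>"
    using B C by eventually_elim (auto intro!: mult_mono)
  then show ?thesis using assms by (intro ess_boundedI) (auto simp: ess_bounded_def)
qed

lemma ess_bounded_inner:
  assumes "ess_bounded M f" "ess_bounded M g"
  shows "ess_bounded M (\<lambda>x. inner (f x) (g x))"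
proof -
  obtain B C where B: "AE x in M. norm (f x) \<le> B" and C: "AE x in M. norm (g x) \<le> C"
    using assms by (auto simp: ess_bounded_def)
  have "AE x in M. norm (inner (f x) (g x)) \<le> \<bar>B\<bar> * \<bar>C\<bar>"
    using B C
  proof eventually_elim
    case (elim x)
    have "norm (inner (f x) (g x)) \<le> norm (f x) * norm (g x)"
      by (simp add: Cauchy_Schwarz_ineq2)
    also have "\<dots> \<le> \<bar>B\<bar> * \<bar>C\<bar>" using elim by (intro mult_mono) auto
    finally show ?case .
  qed
  then show ?thesis using assms by (intro ess_boundedI) (auto simp: ess_bounded_def)
qed

lemma ess_bounded_inner_const: "ess_bounded M f \<Longrightarrow> finite_measure M \<Longrightarrow> ess_bounded M (\<lambda>x. inner (f x) a)"
  by (rule ess_bounded_inner) (auto intro!: ess_boundedI[of _ _ "norm a"])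

lemma (in finite_measure) integrable_ess_bounded: "ess_bounded M f \<Longrightarrow> integrable M f"
  unfolding ess_bounded_def using integrable_const_bound by blast

text \<open>Lebesgue measure is complete, so all subsets of a null set are measurable. This takes
  care of unspecified values of \<open>jacobian\<close> on the faces.\<close>

lemma borel_measurable_null_set:
  assumes "negligible N"
  shows "f \<in> measurable (lebesgue_on N) M \<longleftrightarrow> f \<in> N \<rightarrow> space M"
proof
  assume f: "f \<in> N \<rightarrow> space M"
  show "f \<in> measurable (lebesgue_on N) M"
  proof (rule measurableI)
    show "f -` A \<inter> space (lebesgue_on N) \<in> sets (lebesgue_on N)" for A
    proof -
      have "f -` A \<inter> N \<in> sets lebesgue"
        by (rule negligible_imp_sets, rule negligible_subset[OF assms]) auto
      then show ?thesis
        using negligible_imp_sets[OF assms] by (subst sets_restrict_space_iff) auto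
    qed
  qed (use f in auto)
qed (auto dest: measurable_space)

section \<open>Measurability and bounds for finite element functions and their Jacobians\<close>

context tet_mesh
begin

lemma domain_lmeasurable: "\<Omega> \<in> lmeasurable"
  using open_domain bounded_domain by (simp add: lmeasurable_open)

lemma domain_sets: "\<Omega> \<in> sets lebesgue"
  using domain_lmeasurable by (rule fmeasurableD)

sublocale finite_measure "lebesgue_on \<Omega>"
  by (rule finite_measure_lebesgue_on[OF domain_lmeasurable])

lemma ess_bounded_continuous:
  fixes f :: "real^3 \<Rightarrow> 'b::euclidean_space"
  assumes "continuous_on (closure \<Omega>) f"
  shows "ess_bounded (lebesgue_on \<Omega>) f"
proof -
  have "compact (closure \<Omega>)" using bounded_domain by simp
  then have "bounded (f ` closure \<Omega>)"
    using assms by (intro compact_imp_bounded compact_continuous_image)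
  then obtain B where B: "\<And>x. x \<in> closure \<Omega> \<Longrightarrow> norm (f x) \<le> B"
    by (auto simp: bounded_iff)
  show ?thesis
  proof (rule ess_boundedI)
    show "f \<in> borel_measurable (lebesgue_on \<Omega>)"
      using continuous_on_subset[OF assms closure_subset] domain_sets
      by (rule continuous_imp_measurable_on_sets_lebesgue)
    show "AE x in lebesgue_on \<Omega>. norm (f x) \<le> B"
      using B closure_subset by (intro AE_I2) auto
  qed
qed

definition regular_points :: "(real^3) set" where
  "regular_points = (\<Union>K\<in>\<T>. interior K)"

text \<open>The exceptional points lie on the frontiers of finitely many convex sets.\<close>

lemma negligible_irregular: "negligible (\<Omega> - regular_points)"
proof (rule negligible_subset)
  show "negligible (\<Union>K\<in>\<T>. frontier K)"
    using finite_mesh element_convex by (intro negligible_Union) (auto intro: negligible_convex_frontier)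
  show "\<Omega> - regular_points \<subseteq> (\<Union>K\<in>\<T>. frontier K)"
  proof
    fix x assume x: "x \<in> \<Omega> - regular_points"
    then obtain K where "K \<in> \<T>" "x \<in> K" using domain_subset by blast
    with x show "x \<in> (\<Union>K\<in>\<T>. frontier K)"
      using closure_subset by (fastforce simp: regular_points_def frontier_def)
  qed
qed

lemma AE_regular: "AE x in lebesgue_on \<Omega>. x \<in> regular_points"
proof (rule AE_I')
  show "\<Omega> - regular_points \<in> null_sets (lebesgue_on \<Omega>)"
    using negligible_irregular domain_sets
    by (subst null_sets_restrict_space) (auto simp: negligible_iff_null_sets)
qed auto

lemma P1_3_piece:
  assumes u: "u \<in> P1_space3 \<Omega> \<T>" and K: "K \<in> \<T>"
  obtains G :: "real^3^3" and c where "\<And>x. x \<in> K \<Longrightarrow> u x = G *v x + c"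
proof -
  have "\<exists>a c. \<forall>x\<in>K. u x $ l = inner a x + c" for l
    using u K by (auto simp: P1_space3_def P1_space_def)
  then obtain a c where "\<And>l x. x \<in> K \<Longrightarrow> u x $ l = inner (a l) x + c l" by metis
  then have "u x = (\<chi> l. a l) *v x + (\<chi> l. c l)" if "x \<in> K" for x
    using that by (simp add: Finite_Cartesian_Product.vec_eq_iff matrix_vector_mul_component)
  then show thesis by (rule that)
qed

lemma P1_3_jacobian:
  assumes u: "u \<in> P1_space3 \<Omega> \<T>" and K: "K \<in> \<T>"
  obtains G where "\<And>x. x \<in> interior K \<Longrightarrow> (u has_derivative (\<lambda>h. G *v h)) (at x)"
    "\<And>x. x \<in> interior K \<Longrightarrow> jacobian u (at x) = G"
proof -
  obtain G c where G: "\<And>x. x \<in> K \<Longrightarrow> u x = G *v x + c"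
    using P1_3_piece[OF u K] by blast
  have der: "(u has_derivative (\<lambda>h. G *v h)) (at x)" if x: "x \<in> interior K" for x
  proof (rule has_derivative_transform_within_open[OF _ open_interior x])
    have "((\<lambda>x. G *v x + c) has_derivative (\<lambda>h. G *v h + 0)) (at x)"
      by (intro has_derivative_add bounded_linear_imp_has_derivative matrix_vector_mul_bounded_linear has_derivative_const)
    then show "((\<lambda>x. G *v x + c) has_derivative (\<lambda>h. G *v h)) (at x)" by simp
    show "G *v y + c = u y" if "y \<in> interior K" for y
      using G[of y] that interior_subset[of K] by auto
  qed
  have "jacobian u (at x) = G" if "x \<in> interior K" for x
    unfolding jacobian_def frechet_derivative_at[OF der[OF that], symmetric] by simp
  with der show thesis by (rule that)
qed

lemma P1_3_has_derivative:
  assumes u: "u \<in> P1_space3 \<Omega> \<T>" and x: "x \<in> regular_points"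
  shows "(u has_derivative (\<lambda>h. jacobian u (at x) *v h)) (at x)"
proof -
  obtain K where K: "K \<in> \<T>" "x \<in> interior K" using x by (auto simp: regular_points_def)
  show ?thesis by (rule P1_3_jacobian[OF u K(1)]) (use K(2) in metis)
qed

text \<open>The Jacobian is constant on each open element. Measurability is checked on these pieces
  and on the null remainder, and the sum of the norms of the finitely many constants is a
  bound.\<close>

lemma ess_bounded_jacobian:
  assumes u: "u \<in> P1_space3 \<Omega> \<T>"
  shows "ess_bounded (lebesgue_on \<Omega>) (\<lambda>x. jacobian u (at x))"
proof -
  have "\<forall>K\<in>\<T>. \<exists>G. \<forall>x\<in>interior K. jacobian u (at x) = G"
    using P1_3_jacobian[OF u] by metis
  then obtain G where G: "\<And>K x. K \<in> \<T> \<Longrightarrow> x \<in> interior K \<Longrightarrow> jacobian u (at x) = G K"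
    by metis
  show ?thesis
  proof (rule ess_boundedI)
    show "(\<lambda>x. jacobian u (at x)) \<in> borel_measurable (lebesgue_on \<Omega>)"
    proof (rule measurable_piecewise_restrict[where C = "insert (\<Omega> - regular_points) (interior ` \<T>)"])
      fix A assume "A \<in> insert (\<Omega> - regular_points) (interior ` \<T>)"
      then consider "A = \<Omega> - regular_points" | K where "K \<in> \<T>" "A = interior K" by blast
      then show "A \<inter> space (lebesgue_on \<Omega>) \<in> sets (lebesgue_on \<Omega>)"
        using negligible_imp_sets[OF negligible_irregular] domain_sets
        by cases (auto simp: sets_restrict_space_iff Int_commute intro!: sets.Int)
      from \<open>A \<in> _\<close> consider "A = \<Omega> - regular_points" | K where "K \<in> \<T>" "A = interior K" by blast
      then show "(\<lambda>x. jacobian u (at x)) \<in> borel_measurable (restrict_space (lebesgue_on \<Omega>) A)"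
      proof cases
        case 1
        have "restrict_space (lebesgue_on \<Omega>) A = lebesgue_on (\<Omega> - regular_points)"
          unfolding 1 using domain_sets negligible_imp_sets[OF negligible_irregular]
          by (subst restrict_restrict_space) (auto intro: arg_cong2[of _ _ _ _ restrict_space])
        then show ?thesis by (simp add: borel_measurable_null_set[OF negligible_irregular])
      next
        case 2
        then show ?thesis
          by (subst measurable_cong[where g = "\<lambda>_. G K"]) (auto simp: space_restrict_space G)
      qed
    qed (auto simp: finite_mesh regular_points_def countable_finite)
    have G_le: "norm (G K) \<le> (\<Sum>K\<in>\<T>. norm (G K))" if "K \<in> \<T>" for K
      using that finite_mesh by (intro member_le_sum) auto
    show "AE x in lebesgue_on \<Omega>. norm (jacobian u (at x)) \<le> (\<Sum>K\<in>\<T>. norm (G K))"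
      using AE_regular by eventually_elim (use G G_le in \<open>auto simp: regular_points_def\<close>)
  qed
qed

lemma P1_3_continuous: "u \<in> P1_space3 \<Omega> \<T> \<Longrightarrow> continuous_on (closure \<Omega>) u"
  using continuous_on_vec_lambda[of "closure \<Omega>" "\<lambda>l x. u x $ l"]
  by (simp add: P1_space3_def P1_space_def)

end

section \<open>Weak gradients of finite element functions\<close>

lemma integral_difference_quotient:
  fixes g :: "'a::euclidean_space \<Rightarrow> real"
  assumes "integrable lborel g"
  shows "integral\<^sup>L lebesgue (\<lambda>x. (g (x + a) - g x) / t) = 0"
proof -
  have g: "g \<in> borel_measurable borel" using assms by auto
  have "integrable (distr lborel borel ((+) a)) g"
    using assms by (simp add: lborel_distr_plus)
  then have shift: "integrable lborel (\<lambda>x. g (x + a))"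
    using g by (simp add: integrable_distr_eq add.commute)
  have "integral\<^sup>L lborel g = integral\<^sup>L (distr lborel borel ((+) a)) g"
    by (simp add: lborel_distr_plus)
  also have "\<dots> = integral\<^sup>L lborel (\<lambda>x. g (x + a))"
    using g by (subst integral_distr) (simp_all add: add.commute)
  finally have "integral\<^sup>L lborel (\<lambda>x. (g (x + a) - g x) / t) = 0"
    using assms shift by simp
  moreover have "(\<lambda>x. (g (x + a) - g x) / t) \<in> borel_measurable lborel"
    using g by measurable
  \<comment> \<open>Translation invariance was used for \<open>lborel\<close>; the result passes to
    its completion because the integrand is Borel measurable.\<close>
  ultimately show ?thesis by (subst integral_completion) simp_all
qed

text \<open>Integration by parts without boundary terms. The Lipschitz bound is asked only for steps
  below \<delta>, because in the application a segment starting or ending in the support must stay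
  inside the domain.\<close>

lemma integral_directional_derivative_eq_0:
  fixes g D :: "'a::euclidean_space \<Rightarrow> real"
  assumes g: "integrable lborel g" and D: "D \<in> borel_measurable lebesgue"
    and \<delta>: "0 < \<delta>"
    and lip: "\<And>x t. 0 < t \<Longrightarrow> t < \<delta> \<Longrightarrow> \<bar>g (x + t *\<^sub>R e) - g x\<bar> \<le> C * t"
    and supp: "bounded {x. g x \<noteq> 0}"
    and der: "AE x in lebesgue. ((\<lambda>t. g (x + t *\<^sub>R e)) has_real_derivative D x) (at 0)"
  shows "integral\<^sup>L lebesgue D = 0"
proof -
  \<comment> \<open>The double successor makes every step strictly smaller than \<delta>, also for
    \<open>n = 0\<close>.\<close>
  define t :: "nat \<Rightarrow> real" where "t n = \<delta> * inverse (real (Suc (Suc n)))" for n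
  have t: "0 < t n" "t n < \<delta>" for n
  proof -
    show "0 < t n" using \<delta> by (simp add: t_def)
    have "inverse (real (Suc (Suc n))) < 1" by (simp add: divide_simps inverse_eq_divide)
    then show "t n < \<delta>" using mult_strict_left_mono[OF _ \<delta>] unfolding t_def by fastforce
  qed
  have "t \<longlonglongrightarrow> \<delta> * 0"
    unfolding t_def by (rule tendsto_mult[OF tendsto_const LIMSEQ_Suc[OF LIMSEQ_inverse_real_of_nat]])
  then have t_lim: "filterlim t (at 0) sequentially"
    using t(1) by (simp add: filterlim_at less_imp_neq[symmetric])
  define q where "q n x = (g (x + t n *\<^sub>R e) - g x) / t n" for n x
  obtain R where R: "\<And>x. g x \<noteq> 0 \<Longrightarrow> norm x \<le> R"
    using supp by (auto simp: bounded_iff)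
  \<comment> \<open>The quotient at \<open>x\<close> can be nonzero only if \<open>x\<close> or its
    translate lies in the ball of radius \<open>R\<close>; steps shorter than \<delta> thus keep
    \<open>x\<close> in this larger ball.\<close>
  define w where "w x = C * indicator (cball 0 (R + \<delta> * norm e)) x" for x :: 'a
  have g_meas: "g \<in> borel_measurable borel" using g by auto
  have q_le: "norm (q n x) \<le> w x" for n x
  proof (cases "x \<in> cball 0 (R + \<delta> * norm e)")
    case True
    then show ?thesis
      using lip[OF t, of x n] t(1)[of n] by (simp add: q_def w_def abs_divide divide_le_eq)
  next
    case False
    have "t n * norm e \<le> \<delta> * norm e" using t(2)[of n] by (intro mult_right_mono) auto
    moreover have "norm x - norm (t n *\<^sub>R e) \<le> norm (x + t n *\<^sub>R e)"
      by (rule norm_diff_ineq)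
    moreover have "0 \<le> \<delta> * norm e" using \<delta> by simp
    moreover have "norm (t n *\<^sub>R e) = t n * norm e" using t(1)[of n] by simp
    moreover have "R + \<delta> * norm e < norm x" using False by simp
    ultimately have "R < norm (x + t n *\<^sub>R e)" "R < norm x" by linarith+
    then have "g (x + t n *\<^sub>R e) = 0" "g x = 0" using R by (meson not_le)+
    then show ?thesis using False by (simp add: q_def w_def)
  qed
  have "(\<lambda>n. integral\<^sup>L lebesgue (q n)) \<longlonglongrightarrow> integral\<^sup>L lebesgue D"
  proof (rule integral_dominated_convergence[where w = w])
    have "(\<lambda>x. (g (x + t n *\<^sub>R e) - g x) / t n) \<in> borel_measurable lborel" for n
      using g_meas by measurable
    then show "q n \<in> borel_measurable lebesgue" for n
      unfolding q_def by (rule measurable_completion)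
    show "integrable lebesgue w"
      unfolding w_def by (intro integrable_mult_right integrable_real_indicator) (use emeasure_bounded_finite[OF bounded_cball] in \<open>auto simp: less_top\<close>)
    show "AE x in lebesgue. (\<lambda>n. q n x) \<longlonglongrightarrow> D x"
      using der
    proof eventually_elim
      case (elim x)
      have "((\<lambda>h. (g (x + h *\<^sub>R e) - g x) / h) \<longlongrightarrow> D x) (at 0)"
        using elim by (simp add: DERIV_def)
      from filterlim_compose[OF this t_lim] show ?case by (simp add: q_def)
    qed
  qed (use D q_le in auto)
  moreover have "integral\<^sup>L lebesgue (q n) = 0" for n
    unfolding q_def using g by (rule integral_difference_quotient)
  ultimately show ?thesis by (simp add: LIMSEQ_const_iff)
qed

text \<open>Order 0 of \<open>C_times_diff\<close> gives continuity and order 1 gives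
  differentiability with continuous partial derivatives. The last claim holds because the function
  vanishes in a neighbourhood of every point off its support.\<close>

lemma
  assumes "\<psi> \<in> test_functions \<Omega>"
  shows test_function_partial_deriv: "((\<lambda>t. \<psi> (x + t *\<^sub>R axis j 1)) has_real_derivative partial_deriv j \<psi> (x + s *\<^sub>R axis j 1)) (at s)"
    and test_function_continuous: "continuous_on UNIV \<psi>"
    and partial_deriv_continuous: "continuous_on UNIV (partial_deriv j \<psi>)"
    and test_function_zero: "x \<notin> closure {x. \<psi> x \<noteq> 0} \<Longrightarrow> \<psi> x = 0"
    and partial_deriv_zero: "x \<notin> closure {x. \<psi> x \<noteq> 0} \<Longrightarrow> partial_deriv j \<psi> x = 0"
proof -
  have C: "C_times_diff r \<psi>" for r using assms by (simp add: test_functions_def)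
  have diff: "\<psi> differentiable (at y)" for y using C[of "Suc 0"] by simp
  show der: "((\<lambda>t. \<psi> (x + t *\<^sub>R axis j 1)) has_real_derivative partial_deriv j \<psi> (x + s *\<^sub>R axis j 1)) (at s)" for x s
  proof -
    have "(\<psi> has_derivative frechet_derivative \<psi> (at (x + s *\<^sub>R axis j 1))) (at (x + s *\<^sub>R axis j 1))"
      using diff by (simp add: frechet_derivative_works)
    moreover have "((\<lambda>t. x + t *\<^sub>R axis j 1) has_derivative (\<lambda>t. t *\<^sub>R axis j 1)) (at s)"
      by (auto intro!: derivative_eq_intros)
    ultimately have "((\<lambda>t. \<psi> (x + t *\<^sub>R axis j 1)) has_derivative
        (\<lambda>t. frechet_derivative \<psi> (at (x + s *\<^sub>R axis j 1)) (t *\<^sub>R axis j 1))) (at s)"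
      using has_derivative_compose by fastforce
    then show ?thesis
      unfolding has_field_derivative_def partial_deriv_def
      using linear_frechet_derivative[OF diff] by (simp add: linear_cmul mult.commute[of _ "frechet_derivative _ _ _"] mult_commute_abs)
  qed
  show "continuous_on UNIV \<psi>" using C[of 0] by simp
  show "continuous_on UNIV (partial_deriv j \<psi>)" using C[of "Suc 0"] by simp
  show zero: "\<psi> x = 0" if "x \<notin> closure {x. \<psi> x \<noteq> 0}" for x
    using that closure_subset[of "{x. \<psi> x \<noteq> 0}"] by blast
  show "partial_deriv j \<psi> x = 0" if "x \<notin> closure {x. \<psi> x \<noteq> 0}"
  proof -
    have "(\<psi> has_derivative (\<lambda>_. 0)) (at x)"
    proof (rule has_derivative_transform_within_open)
      show "((\<lambda>_. 0) has_derivative (\<lambda>_. 0)) (at x)" by (rule has_derivative_const)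
      show "open (- closure {x. \<psi> x \<noteq> 0})" by (rule open_Compl[OF closed_closure])
      show "x \<in> - closure {x. \<psi> x \<noteq> 0}" unfolding Compl_iff by (rule that)
      show "0 = \<psi> y" if "y \<in> - closure {x. \<psi> x \<noteq> 0}" for y
        using zero[OF ComplD[OF that]] by (rule sym)
    qed
    from frechet_derivative_at[OF this] show ?thesis by (simp add: partial_deriv_def fun_eq_iff)
  qed
qed

text \<open>The function and its partial derivative are bounded, being continuous and zero off a
  compact set. The mean value theorem along the direction gives the Lipschitz bound, and the sum of
  the two bounds serves as one constant.\<close>

lemma test_functionE:
  assumes \<psi>: "\<psi> \<in> test_functions \<Omega>"
  obtains S B where "compact S" "S \<subseteq> \<Omega>" "\<And>x. x \<notin> S \<Longrightarrow> \<psi> x = 0" "\<And>x. x \<notin> S \<Longrightarrow> partial_deriv j \<psi> x = 0"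
    "0 \<le> B" "\<And>x. \<bar>\<psi> x\<bar> \<le> B" "\<And>x t. \<bar>\<psi> (x + t *\<^sub>R axis j 1) - \<psi> x\<bar> \<le> B * \<bar>t\<bar>"
proof -
  obtain S where S_def: "S = closure {x. \<psi> x \<noteq> 0}" by blast
  have S: "compact S" "S \<subseteq> \<Omega>" using \<psi> by (simp_all add: test_functions_def S_def)
  have zero: "\<psi> x = 0" "partial_deriv j \<psi> x = 0" if "x \<notin> S" for x
    using test_function_zero[OF \<psi> that[unfolded S_def]] partial_deriv_zero[OF \<psi> that[unfolded S_def]] by auto
  have bound: "\<exists>B. \<forall>x. \<bar>f x\<bar> \<le> B" if "continuous_on UNIV f" "\<And>x. x \<notin> S \<Longrightarrow> f x = 0" for f :: "real^3 \<Rightarrow> real"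
  proof -
    have "compact (f ` S)"
      using continuous_on_subset[OF that(1) subset_UNIV] S(1) by (rule compact_continuous_image)
    then obtain B where B: "\<And>x. x \<in> S \<Longrightarrow> \<bar>f x\<bar> \<le> B"
      by (metis bounded_iff compact_imp_bounded imageI real_norm_def)
    have "\<bar>f x\<bar> \<le> max B 0" for x
      using B[of x] that(2)[of x] by (cases "x \<in> S") auto
    then show ?thesis by blast
  qed
  obtain B1 where B1: "\<And>x. \<bar>\<psi> x\<bar> \<le> B1"
    using bound[OF test_function_continuous[OF \<psi>] zero(1)] by blast
  obtain B2 where B2: "\<And>x. \<bar>partial_deriv j \<psi> x\<bar> \<le> B2"
    using bound[OF partial_deriv_continuous[OF \<psi>] zero(2)] by blast
  have *: "0 \<le> B1" "0 \<le> B2" using B1[of 0] B2[of 0] by linarith+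
  have "\<bar>\<psi> (x + t *\<^sub>R axis j 1) - \<psi> x\<bar> \<le> (B1 + B2) * \<bar>t\<bar>" for x t
  proof -
    have "norm (\<psi> (x + t *\<^sub>R axis j 1) - \<psi> (x + 0 *\<^sub>R axis j 1)) \<le> B2 * norm (t - 0)"
    proof (rule field_differentiable_bound)
      show "((\<lambda>t. \<psi> (x + t *\<^sub>R axis j 1)) has_field_derivative partial_deriv j \<psi> (x + s *\<^sub>R axis j 1)) (at s within UNIV)" for s
        using test_function_partial_deriv[OF \<psi>] by simp
      show "norm (partial_deriv j \<psi> (x + s *\<^sub>R axis j 1)) \<le> B2" for s
        using B2 by simp
    qed auto
    also have "B2 * norm (t - 0) \<le> (B1 + B2) * \<bar>t\<bar>"
      using * by (simp add: mult_right_mono)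
    finally show ?thesis by simp
  qed
  moreover have "\<bar>\<psi> x\<bar> \<le> B1 + B2" for x using B1[of x] * by linarith
  moreover have "0 \<le> B1 + B2" using * by simp
  ultimately show thesis using S zero by (intro that)
qed

section \<open>Integration by parts against test functions\<close>

context tet_mesh
begin

text \<open>The domain need not be convex, so the bound is stated along segments inside it. The
  preimages of the elements cover the parameter interval by finitely many closed sets; on each the
  function is affine in the parameter, and the local Lipschitz bounds glue.\<close>

lemma P1_segment_lipschitz:
  assumes u: "u \<in> P1_space \<Omega> \<T>"
  obtains L where "0 \<le> L"
    "\<And>x y. closed_segment x y \<subseteq> \<Omega> \<Longrightarrow> \<bar>u y - u x\<bar> \<le> L * norm (y - x)"
proof -
  obtain a c where ac: "\<And>K x. K \<in> \<T> \<Longrightarrow> x \<in> K \<Longrightarrow> u x = inner (a K) x + c K"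
    using u by (auto simp: P1_space_def) metis
  define L where "L = (\<Sum>K\<in>\<T>. norm (a K))"
  have L0: "0 \<le> L" by (auto simp: L_def intro: sum_nonneg)
  have aL: "norm (a K) \<le> L" if "K \<in> \<T>" for K
    unfolding L_def using that finite_mesh by (intro member_le_sum) auto
  have "\<bar>u y - u x\<bar> \<le> L * norm (y - x)" if seg: "closed_segment x y \<subseteq> \<Omega>" for x y
  proof -
    define p where "p s = x + s *\<^sub>R (y - x)" for s :: real
    have "(L * norm (y - x))-lipschitz_on {0..1} (\<lambda>s. u (p s))"
    proof (rule lipschitz_on_closed_Union[where I = \<T> and U = "\<lambda>K. p -` K"])
      show "(L * norm (y - x))-lipschitz_on (p -` K) (\<lambda>s. u (p s))" if K: "K \<in> \<T>" for K
      proof (rule lipschitz_onI)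
        fix s s' assume "s \<in> p -` K" "s' \<in> p -` K"
        then have "u (p s) - u (p s') = (s - s') * inner (a K) (y - x)"
          using ac[OF K] by (simp add: p_def algebra_simps)
        then have "dist (u (p s)) (u (p s')) = \<bar>inner (a K) (y - x)\<bar> * dist s s'"
          by (simp add: dist_real_def abs_mult mult.commute)
        also have "\<bar>inner (a K) (y - x)\<bar> \<le> L * norm (y - x)"
          using Cauchy_Schwarz_ineq2[of "a K" "y - x"] mult_right_mono[OF aL[OF K], of "norm (y - x)"] by simp
        finally show "dist (u (p s)) (u (p s')) \<le> L * norm (y - x) * dist s s'"
          by (simp add: mult_right_mono)
      qed (use L0 in simp)
      show "closed (p -` K)" if "K \<in> \<T>" for K
        unfolding p_def using element_compact[OF that]
        by (intro closed_vimage compact_imp_closed continuous_intros)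
      have "p s \<in> \<Omega>" if "s \<in> {0..1}" for s
        using seg that by (auto simp: p_def in_segment algebra_simps intro!: subsetD[OF seg] exI[of _ s])
      then show "{0..1} \<subseteq> (\<Union>K\<in>\<T>. p -` K)" using domain_subset by blast
    qed (use L0 finite_mesh in auto)
    from lipschitz_onD[OF this, of 1 0] show ?thesis
      by (simp add: p_def dist_real_def)
  qed
  with L0 show thesis by (rule that)
qed

lemma weak_gradient_P1_3:
  assumes u: "u \<in> P1_space3 \<Omega> \<T>"
  shows "weak_gradient \<Omega> u (\<lambda>x. jacobian u (at x))"
  unfolding weak_gradient_def
proof (intro ballI allI)
  fix \<psi> i j assume \<psi>: "\<psi> \<in> test_functions \<Omega>"
  let ?e = "axis j 1 :: real^3"
  obtain S B where S: "compact S" "S \<subseteq> \<Omega>"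
    and zero: "\<And>x. x \<notin> S \<Longrightarrow> \<psi> x = 0" "\<And>x. x \<notin> S \<Longrightarrow> partial_deriv j \<psi> x = 0"
    and B: "0 \<le> B" "\<And>x. \<bar>\<psi> x\<bar> \<le> B" "\<And>x t. \<bar>\<psi> (x + t *\<^sub>R ?e) - \<psi> x\<bar> \<le> B * \<bar>t\<bar>"
    using test_functionE[OF \<psi>, of j] by blast
  have ui: "(\<lambda>x. u x $ i) \<in> P1_space \<Omega> \<T>" using u by (simp add: P1_space3_def)
  then have ui_cont: "continuous_on (closure \<Omega>) (\<lambda>x. u x $ i)" by (simp add: P1_space_def)
  \<comment> \<open>A margin between the support and the complement of the domain.\<close>
  obtain \<delta> where \<delta>: "0 < \<delta>" "(\<Union>x\<in>S. ball x \<delta>) \<subseteq> \<Omega>"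
    using compact_subset_open_imp_ball_epsilon_subset[OF S(1) open_domain S(2)] by blast
  obtain L where L: "0 \<le> L" "\<And>x y. closed_segment x y \<subseteq> \<Omega> \<Longrightarrow> \<bar>u y $ i - u x $ i\<bar> \<le> L * norm (y - x)"
    using P1_segment_lipschitz[OF ui] by blast
  obtain Bu where Bu: "\<And>x. \<bar>u x $ i\<bar> \<le> Bu" using P1_bounded[OF ui] by blast
  have Bu0: "0 \<le> Bu" using Bu[of 0] by linarith
  have cont: "continuous_on A \<psi>" "continuous_on A (partial_deriv j \<psi>)" for A
    using test_function_continuous[OF \<psi>] partial_deriv_continuous[OF \<psi>] continuous_on_subset by blast+
  define g where "g x = u x $ i * \<psi> x" for x
  define D where "D x = u x $ i * partial_deriv j \<psi> x + jacobian u (at x) $ i $ j * \<psi> x" for x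
  \<comment> \<open>The zero extension of \<open>u\<close> may jump at the boundary, but there
    \<psi> is already zero: \<Omega> and the complement of \<open>S\<close> are open and cover the
    space.\<close>
  have g_cont: "continuous_on UNIV g"
  proof -
    have "continuous_on \<Omega> g" unfolding g_def
      by (rule continuous_on_mult[OF continuous_on_subset[OF ui_cont closure_subset] cont(1)])
    moreover have "continuous_on (- S) g"
      using continuous_on_const[of "- S" 0]
      by (rule continuous_on_eq) (simp add: g_def zero)
    ultimately have "continuous_on (\<Omega> \<union> - S) g"
      using open_domain open_Compl[OF compact_imp_closed[OF S(1)]] by (intro continuous_on_open_Un)
    moreover have "\<Omega> \<union> - S = UNIV" using S(2) by blast
    ultimately show ?thesis by simp
  qed
  have part: "ess_bounded (lebesgue_on \<Omega>) (\<lambda>x. u x $ i * partial_deriv j \<psi> x)"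
    by (rule ess_bounded_continuous[OF continuous_on_mult[OF ui_cont cont(2)]])
  have "ess_bounded (lebesgue_on \<Omega>) (\<lambda>x. inner (jacobian u (at x)) (axis i ?e))"
    using ess_bounded_jacobian[OF u] finite_measure_axioms by (rule ess_bounded_inner_const)
  then have "ess_bounded (lebesgue_on \<Omega>) (\<lambda>x. jacobian u (at x) $ i $ j)"
    by (simp add: inner_axis)
  moreover have "ess_bounded (lebesgue_on \<Omega>) \<psi>"
    by (rule ess_bounded_continuous[OF cont(1)])
  ultimately have jac: "ess_bounded (lebesgue_on \<Omega>) (\<lambda>x. jacobian u (at x) $ i $ j * \<psi> x)"
    using ess_bounded_scaleR by fastforce
  have D_on: "integrable (lebesgue_on \<Omega>) D"
    unfolding D_def using part jac by (intro Bochner_Integration.integrable_add integrable_ess_bounded)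
  have D_eq: "(\<lambda>x. if x \<in> \<Omega> then D x else 0) = D"
  proof
    show "(if x \<in> \<Omega> then D x else 0) = D x" for x
      using zero[of x] S(2) by (cases "x \<in> S") (auto simp: D_def)
  qed
  have "integral\<^sup>L lebesgue D = 0"
  proof (rule integral_directional_derivative_eq_0[where g = g and e = ?e and \<delta> = \<delta> and C = "Bu * B + L * B"])
    have "{x. g x \<noteq> 0} \<subseteq> S" using zero(1) unfolding g_def by force
    then show "bounded {x. g x \<noteq> 0}"
      by (rule bounded_subset[OF compact_imp_bounded[OF S(1)]])
    have "integrable lborel (\<lambda>x. indicator S x *\<^sub>R g x)"
      using S(1) continuous_on_subset[OF g_cont subset_UNIV] by (rule borel_integrable_compact)
    moreover have "(\<lambda>x. indicator S x *\<^sub>R g x) = g"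
    proof
      show "indicator S x *\<^sub>R g x = g x" for x
        using zero(1)[of x] by (cases "x \<in> S") (simp_all add: g_def)
    qed
    ultimately show "integrable lborel g" by simp
    show "D \<in> borel_measurable lebesgue"
      using borel_measurable_integrable[OF D_on] borel_measurable_if[OF domain_sets, of D] D_eq by simp
    show "\<bar>g (x + t *\<^sub>R ?e) - g x\<bar> \<le> (Bu * B + L * B) * t" if t: "0 < t" "t < \<delta>" for x t
    \<comment> \<open>If one endpoint is in \<open>S\<close>, the segment lies in a ball of radius
      \<delta> about it and hence in \<Omega>, so the product can be estimated term by term.
      Otherwise both values of \<open>g\<close> are zero.\<close>
    proof (cases "x \<in> S \<or> x + t *\<^sub>R ?e \<in> S")
      case True
      have "closed_segment x (x + t *\<^sub>R ?e) \<subseteq> ball x \<delta>" "closed_segment x (x + t *\<^sub>R ?e) \<subseteq> ball (x + t *\<^sub>R ?e) \<delta>"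
        using t by (intro closed_segment_subset; auto simp: dist_norm norm_axis_1)+
      then have "closed_segment x (x + t *\<^sub>R ?e) \<subseteq> \<Omega>" using True \<delta>(2) by blast
      then have 1: "\<bar>u (x + t *\<^sub>R ?e) $ i - u x $ i\<bar> \<le> L * t"
        using L(2) t by (fastforce simp: norm_axis_1)
      have "g (x + t *\<^sub>R ?e) - g x = u (x + t *\<^sub>R ?e) $ i * (\<psi> (x + t *\<^sub>R ?e) - \<psi> x)
          + (u (x + t *\<^sub>R ?e) $ i - u x $ i) * \<psi> x"
        by (simp add: g_def algebra_simps)
      also have "\<bar>\<dots>\<bar> \<le> \<bar>u (x + t *\<^sub>R ?e) $ i\<bar> * \<bar>\<psi> (x + t *\<^sub>R ?e) - \<psi> x\<bar>
          + \<bar>u (x + t *\<^sub>R ?e) $ i - u x $ i\<bar> * \<bar>\<psi> x\<bar>"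
        unfolding abs_mult[symmetric] by (rule abs_triangle_ineq)
      also have "\<dots> \<le> Bu * (B * \<bar>t\<bar>) + (L * t) * B"
        using t Bu0 L(1) by (intro add_mono mult_mono Bu B 1) simp_all
      finally show ?thesis using t by (simp add: algebra_simps)
    next
      case False
      then show ?thesis using zero(1) t B(1) L(1) Bu0 by (simp add: g_def)
    qed
    \<comment> \<open>Inside \<Omega> this leaves points where the product rule applies. Outside
      \<Omega>, where nothing is known about \<open>jacobian u\<close>, both \<open>g\<close> and
      \<open>D\<close> vanish with the test function.\<close>
    have "AE x in lebesgue. x \<notin> \<Omega> - regular_points"
      using negligible_irregular by (intro AE_not_in) (simp add: negligible_iff_null_sets)
    then show "AE x in lebesgue. ((\<lambda>t. g (x + t *\<^sub>R ?e)) has_real_derivative D x) (at 0)"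
    proof eventually_elim
      case (elim x)
      have dpsi: "((\<lambda>t. \<psi> (x + t *\<^sub>R ?e)) has_real_derivative partial_deriv j \<psi> x) (at 0)"
        using test_function_partial_deriv[OF \<psi>, of x j 0] by simp
      show ?case
      proof (cases "x \<in> \<Omega>")
        case True
        with elim have "x \<in> regular_points" by blast
        then have "(u has_derivative (\<lambda>h. jacobian u (at x) *v h)) (at (x + 0 *\<^sub>R ?e))"
          using P1_3_has_derivative[OF u] by simp
        moreover have "((\<lambda>t. x + t *\<^sub>R ?e) has_derivative (\<lambda>t. t *\<^sub>R ?e)) (at 0)"
          by (auto intro!: derivative_eq_intros)
        ultimately have "((\<lambda>t. u (x + t *\<^sub>R ?e)) has_derivative (\<lambda>t. jacobian u (at x) *v (t *\<^sub>R ?e))) (at 0)"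
          using has_derivative_compose by fastforce
        then have "((\<lambda>t. u (x + t *\<^sub>R ?e) $ i) has_derivative (\<lambda>t. (jacobian u (at x) *v (t *\<^sub>R ?e)) $ i)) (at 0)"
          by (rule bounded_linear.has_derivative[OF bounded_linear_vec_nth])
        moreover have "(\<lambda>t. (jacobian u (at x) *v (t *\<^sub>R ?e)) $ i) = (*) (jacobian u (at x) $ i $ j)"
          by (auto simp: fun_eq_iff matrix_vector_mul_component inner_axis)
        ultimately have "((\<lambda>t. u (x + t *\<^sub>R ?e) $ i) has_real_derivative jacobian u (at x) $ i $ j) (at 0)"
          by (simp add: has_field_derivative_def)
        from DERIV_mult[OF this dpsi] show ?thesis
          by (simp add: g_def D_def algebra_simps)
      next
        case False
        then have x: "x \<notin> S" using S(2) by blast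
        let ?U = "(\<lambda>t. x + t *\<^sub>R ?e) -` (- S)"
        have "open ?U"
          by (rule open_vimage[OF open_Compl[OF compact_imp_closed[OF S(1)]]]) (intro continuous_intros)
        moreover have "0 \<in> ?U" using x by simp
        moreover have "0 = g (x + t *\<^sub>R ?e)" if "t \<in> ?U" for t
          using zero that by (simp add: g_def)
        ultimately have "((\<lambda>t. g (x + t *\<^sub>R ?e)) has_real_derivative 0) (at 0)"
          by (intro has_field_derivative_transform_within_open[OF DERIV_const[of 0]])
        then show ?thesis using zero[OF x] by (simp add: D_def)
      qed
    qed
  qed (use \<delta> in auto)
  then have "integral\<^sup>L (lebesgue_on \<Omega>) D = 0"
    using Lebesgue_Measure.integral_restrict_UNIV[OF domain_sets, of D] D_eq by simp
  then show "integral\<^sup>L (lebesgue_on \<Omega>) (\<lambda>x. u x $ i * partial_deriv j \<psi> x)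
      = - integral\<^sup>L (lebesgue_on \<Omega>) (\<lambda>x. jacobian u (at x) $ i $ j * \<psi> x)"
    unfolding D_def using part jac
    by (subst (asm) Bochner_Integration.integral_add) (auto intro: integrable_ess_bounded)
qed

lemma ess_bounded_L2:
  assumes "ess_bounded (lebesgue_on \<Omega>) f"
  shows "f \<in> L2_space \<Omega>"
  using assms integrable_ess_bounded[OF ess_bounded_inner[OF assms assms]]
  by (simp add: L2_space_def ess_bounded_def power2_norm_eq_inner)

lemma ess_bounded_P1_3: "u \<in> P1_space3 \<Omega> \<T> \<Longrightarrow> ess_bounded (lebesgue_on \<Omega>) u"
  by (intro ess_bounded_continuous P1_3_continuous)

lemma P1_3_H1: "u \<in> P1_space3 \<Omega> \<T> \<Longrightarrow> u \<in> H1_space \<Omega>"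
  unfolding H1_space_def
  by (intro CollectI conjI bexI[where x = "\<lambda>x. jacobian u (at x)"] weak_gradient_P1_3
    ess_bounded_L2 ess_bounded_P1_3 ess_bounded_jacobian)

end

section \<open>The variational problem in coefficients\<close>

text \<open>One time step with its data frozen: \<open>w\<close>, \<kappa> and \<open>q\<close>
  become the weight, the product of \<open>\<beta> k\<close> and \<open>k\<close>, and the
  lower-order term.\<close>

locale tangent_plane_step = tet_mesh +
  fixes N :: nat and z :: "nat \<Rightarrow> real^3" and Tn :: "real^3^3" and m :: "real^3 \<Rightarrow> real^3"
    and lx \<alpha> \<kappa> :: real and w :: "real^3 \<Rightarrow> real" and q :: "real^3 \<Rightarrow> real^3"
  assumes enumeration: "bij_betw z {..<N} (nodes \<T>)"
    and Tn: "Tn ** Tn = Finite_Cartesian_Product.mat 1" "transpose Tn = Tn"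
    and m: "m \<in> M_space \<Omega> \<T>"
    and \<alpha>: "\<alpha> \<noteq> 0" and \<kappa>: "0 \<le> \<kappa>"
    and w_bounded: "ess_bounded (lebesgue_on \<Omega>) w" and w_pos: "\<And>x. 0 < w x"
    and q: "q \<in> L2_space \<Omega>"
begin

abbreviation \<phi> :: "nat \<Rightarrow> real^3 \<Rightarrow> real^3" where
  "\<phi> \<equiv> nodal_basis \<Omega> \<T> z"

abbreviation fe_function :: "real Matrix.vec \<Rightarrow> real^3 \<Rightarrow> real^3" where
  "fe_function c \<equiv> (\<lambda>y. \<Sum>j<3 * N. vec_index c j *\<^sub>R \<phi> j y)"

abbreviation A :: "real mat" where
  "A \<equiv> system_matrix \<Omega> N \<phi> \<alpha> \<kappa> w m"

abbreviation b :: "real Matrix.vec" where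
  "b \<equiv> load_vector \<Omega> N \<phi> lx q m"

abbreviation Q :: "real mat" where
  "Q \<equiv> tangent_matrix N z Tn m"

abbreviation B :: "real mat" where
  "B \<equiv> transpose_mat Q * A * Q"

abbreviation is_v :: "(real^3 \<Rightarrow> real^3) \<Rightarrow> bool" where
  "is_v \<equiv> variational_solution \<Omega> \<T> lx \<kappa> w q m"

abbreviation is_x :: "real Matrix.vec \<Rightarrow> bool" where
  "is_x x \<equiv> x \<in> carrier_vec (2 * N) \<and> B *\<^sub>v x = transpose_mat Q *\<^sub>v b"

definition lhs_form :: "(real^3 \<Rightarrow> real^3) \<Rightarrow> (real^3 \<Rightarrow> real^3) \<Rightarrow> real" where
  "lhs_form u v = L2_inner \<Omega> (\<lambda>x. w x *\<^sub>R u x) v + L2_inner \<Omega> (\<lambda>x. cross3 (m x) (u x)) v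
    + \<kappa> * L2_inner \<Omega> (\<lambda>x. jacobian u (at x)) (\<lambda>x. jacobian v (at x))"

definition rhs_form :: "(real^3 \<Rightarrow> real^3) \<Rightarrow> real" where
  "rhs_form v = - lx\<^sup>2 * L2_inner \<Omega> (\<lambda>x. jacobian m (at x)) (\<lambda>x. jacobian v (at x)) + L2_inner \<Omega> q v"

lemma node: "i < N \<Longrightarrow> z i \<in> nodes \<T>"
  and node_inj: "i < N \<Longrightarrow> j < N \<Longrightarrow> z i = z j \<longleftrightarrow> i = j"
  and node_surj: "p \<in> nodes \<T> \<Longrightarrow> \<exists>i<N. p = z i"
  using enumeration by (auto simp: bij_betw_def inj_on_def)

lemma m_P1_3: "m \<in> P1_space3 \<Omega> \<T>" and m_norm: "i < N \<Longrightarrow> norm (m (z i)) = 1"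
  using m node by (auto simp: M_space_def)

lemma \<phi>_P1_3: "j < 3 * N \<Longrightarrow> \<phi> j \<in> P1_space3 \<Omega> \<T>"
proof -
  assume "j < 3 * N"
  then have "j div 3 < N" by auto
  then show ?thesis
    using P1_scale[OF hat_fun_P1[OF node]] by (simp add: P1_space3_def nodal_basis_def mult.commute)
qed

lemma P1_3_sum:
  assumes "\<And>j. j \<in> I \<Longrightarrow> f j \<in> P1_space3 \<Omega> \<T>" "finite I"
  shows "(\<lambda>y. \<Sum>j\<in>I. c j *\<^sub>R f j y) \<in> P1_space3 \<Omega> \<T>"
  unfolding P1_space3_def
proof (intro CollectI allI)
  fix l
  have "(\<lambda>y. \<Sum>j\<in>I. c j * f j y $ l) \<in> P1_space \<Omega> \<T>"
    using assms by (intro P1_sum P1_scale) (auto simp: P1_space3_def)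
  then show "(\<lambda>y. (\<Sum>j\<in>I. c j *\<^sub>R f j y) $ l) \<in> P1_space \<Omega> \<T>" by simp
qed

lemma fe_function_P1_3: "fe_function c \<in> P1_space3 \<Omega> \<T>"
  by (rule P1_3_sum) (auto intro: \<phi>_P1_3)

lemma fe_function_node:
  assumes "i < N"
  shows "fe_function c (z i) = node_value c i"
proof -
  have "fe_function c (z i) = (\<Sum>k<N. hat_fun \<Omega> \<T> (z k) (z i) *\<^sub>R node_value c k)"
    by (rule sum_nodal_basis)
  also have "\<dots> = (\<Sum>k<N. if k = i then node_value c k else 0)"
    using assms by (intro sum.cong refl) (auto simp: hat_fun_node node node_inj)
  finally show ?thesis using assms by simp
qed

lemma P1_3_eqI:
  assumes "u \<in> P1_space3 \<Omega> \<T>" "v \<in> P1_space3 \<Omega> \<T>" "\<And>i. i < N \<Longrightarrow> u (z i) = v (z i)"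
  shows "u = v"
proof -
  have "(\<lambda>x. u x $ l) = (\<lambda>x. v x $ l)" for l
  proof (rule P1_eqI)
    show "u p $ l = v p $ l" if "p \<in> nodes \<T>" for p
      using node_surj[OF that] assms(3) by auto
  qed (use assms in \<open>simp_all add: P1_space3_def\<close>)
  then have "u x $ l = v x $ l" for x l by metis
  then show ?thesis by (intro ext) (simp add: Finite_Cartesian_Product.vec_eq_iff)
qed

lemma node_value_perp:
  "x \<in> carrier_vec (2 * N) \<Longrightarrow> i < N \<Longrightarrow> inner (node_value (Q *\<^sub>v x) i) (m (z i)) = 0"
  using node_value_tangent[where N = N and z = z and m = m, OF Tn m_norm] by blast

lemma ex1_coefficients:
  "(\<And>i. i < N \<Longrightarrow> inner (a i) (m (z i)) = 0) \<Longrightarrow>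
    \<exists>!x. x \<in> carrier_vec (2 * N) \<and> (\<forall>i<N. node_value (Q *\<^sub>v x) i = a i)"
  using ex1_tangent_coefficients[where N = N and z = z and m = m, OF Tn m_norm] by blast

text \<open>Both inclusions are decided at the nodes: the nodal vectors of
  \<open>Q *\<^sub>v x\<close> are tangent, every tangent family arises in this way, and nodal
  values determine the function.\<close>

lemma K_space_eq: "K_space \<Omega> \<T> m = (\<lambda>x. fe_function (Q *\<^sub>v x)) ` carrier_vec (2 * N)"
proof (intro equalityI subsetI)
  fix v assume v: "v \<in> K_space \<Omega> \<T> m"
  then have perp: "inner (v (z i)) (m (z i)) = 0" if "i < N" for i
    using node[OF that] by (simp add: K_space_def)
  obtain x where x: "x \<in> carrier_vec (2 * N)" "\<And>i. i < N \<Longrightarrow> node_value (Q *\<^sub>v x) i = v (z i)"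
    using ex1_coefficients[of "\<lambda>i. v (z i)"] perp by blast
  have "v = fe_function (Q *\<^sub>v x)"
  proof (rule P1_3_eqI)
    show "v \<in> P1_space3 \<Omega> \<T>" using v by (simp add: K_space_def)
    show "fe_function (Q *\<^sub>v x) \<in> P1_space3 \<Omega> \<T>" by (rule fe_function_P1_3)
    show "v (z i) = fe_function (Q *\<^sub>v x) (z i)" if "i < N" for i
      unfolding fe_function_node[OF that] x(2)[OF that] ..
  qed
  then show "v \<in> (\<lambda>x. fe_function (Q *\<^sub>v x)) ` carrier_vec (2 * N)"
    using x(1) by (rule image_eqI)
next
  fix v assume "v \<in> (\<lambda>x. fe_function (Q *\<^sub>v x)) ` carrier_vec (2 * N)"
  then obtain x where x: "x \<in> carrier_vec (2 * N)" and v: "v = fe_function (Q *\<^sub>v x)" by blast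
  have "inner (v p) (m p) = 0" if p: "p \<in> nodes \<T>" for p
  proof -
    obtain i where i: "i < N" "p = z i" using node_surj[OF p] by blast
    show ?thesis
      unfolding i(2) v fe_function_node[OF i(1)]
      by (rule node_value_perp[OF x i(1)])
  qed
  then show "v \<in> K_space \<Omega> \<T> m"
    using fe_function_P1_3 unfolding K_space_def v by blast
qed

text \<open>Evaluation at the nodes reduces this to the uniqueness half of
  \<open>ex1_coefficients\<close>.\<close>

lemma fe_function_tangent_inj:
  assumes x: "x \<in> carrier_vec (2 * N)" and y: "y \<in> carrier_vec (2 * N)"
    and eq: "fe_function (Q *\<^sub>v x) = fe_function (Q *\<^sub>v y)"
  shows "x = y"
proof -
  have "node_value (Q *\<^sub>v x) i = node_value (Q *\<^sub>v y) i" if "i < N" for i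
    using fun_cong[OF eq, of "z i"] unfolding fe_function_node[OF that] .
  moreover have "inner (node_value (Q *\<^sub>v x) i) (m (z i)) = 0" if "i < N" for i
    by (rule node_value_perp[OF x that])
  ultimately show ?thesis
    using ex1_coefficients[of "\<lambda>i. node_value (Q *\<^sub>v x) i"] x y by metis
qed

end

section \<open>Integrability and bilinear expansion of inner products\<close>

context tet_mesh
begin

lemma integrable_inner_ess_bounded:
  "ess_bounded (lebesgue_on \<Omega>) f \<Longrightarrow> ess_bounded (lebesgue_on \<Omega>) g \<Longrightarrow>
    integrable (lebesgue_on \<Omega>) (\<lambda>x. inner (f x) (g x))"
  by (intro integrable_ess_bounded ess_bounded_inner)

text \<open>A bounded factor costs a constant, and \<open>s \<le> 1 + s\<^sup>2\<close> turns square
  integrability on a set of finite measure into an integrable majorant.\<close>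

lemma integrable_inner_L2:
  assumes f: "f \<in> L2_space \<Omega>" and g: "ess_bounded (lebesgue_on \<Omega>) g"
  shows "integrable (lebesgue_on \<Omega>) (\<lambda>x. inner (f x) (g x))"
proof -
  obtain C where C: "AE x in lebesgue_on \<Omega>. norm (g x) \<le> C" using g by (auto simp: ess_bounded_def)
  have "integrable (lebesgue_on \<Omega>) (\<lambda>x. \<bar>C\<bar> * (1 + (norm (f x))\<^sup>2))"
    using f by (intro Bochner_Integration.integrable_add integrable_mult_right) (auto simp: L2_space_def)
  then show ?thesis
  proof (rule Bochner_Integration.integrable_bound)
    show "(\<lambda>x. inner (f x) (g x)) \<in> borel_measurable (lebesgue_on \<Omega>)"
      using f g by (auto simp: L2_space_def ess_bounded_def)
    show "AE x in lebesgue_on \<Omega>. norm (inner (f x) (g x)) \<le> norm (\<bar>C\<bar> * (1 + (norm (f x))\<^sup>2))"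
      using C
    proof eventually_elim
      case (elim x)
      have "norm (inner (f x) (g x)) \<le> norm (f x) * norm (g x)" by (simp add: Cauchy_Schwarz_ineq2)
      also have "\<dots> \<le> (1 + (norm (f x))\<^sup>2) * \<bar>C\<bar>"
      proof (rule mult_mono)
        have "2 * norm (f x) \<le> 1 + (norm (f x))\<^sup>2"
          using sum_squares_bound[of 1 "norm (f x)"] by simp
        then show "norm (f x) \<le> 1 + (norm (f x))\<^sup>2" using norm_ge_zero[of "f x"] by linarith
      qed (use elim in auto)
      also have "\<dots> = norm (\<bar>C\<bar> * (1 + (norm (f x))\<^sup>2))"
        by (simp add: abs_mult mult.commute)
      finally show ?case .
    qed
  qed
qed

text \<open>The expansions are assumed almost everywhere only, because the Jacobian of a sum is
  known to be the sum of the Jacobians only at regular points. One statement thus serves the mass,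
  cross product and gradient terms.\<close>

lemma L2_inner_double_sum:
  fixes F :: "nat \<Rightarrow> real^3 \<Rightarrow> 'b::euclidean_space"
  assumes fin: "finite I" "finite J"
    and f: "ess_bounded (lebesgue_on \<Omega>) f" "AE x in lebesgue_on \<Omega>. f x = (\<Sum>j\<in>J. c j *\<^sub>R F j x)"
    and g: "ess_bounded (lebesgue_on \<Omega>) g" "AE x in lebesgue_on \<Omega>. g x = (\<Sum>i\<in>I. d i *\<^sub>R G i x)"
    and F: "\<And>j. j \<in> J \<Longrightarrow> ess_bounded (lebesgue_on \<Omega>) (F j)"
    and G: "\<And>i. i \<in> I \<Longrightarrow> ess_bounded (lebesgue_on \<Omega>) (G i)"
  shows "L2_inner \<Omega> f g = (\<Sum>i\<in>I. \<Sum>j\<in>J. d i * c j * L2_inner \<Omega> (F j) (G i))"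
proof -
  have FG: "integrable (lebesgue_on \<Omega>) (\<lambda>x. inner (F j x) (G i x))" if "i \<in> I" "j \<in> J" for i j
    using F G that by (intro integrable_inner_ess_bounded)
  have "L2_inner \<Omega> f g = integral\<^sup>L (lebesgue_on \<Omega>) (\<lambda>x. \<Sum>i\<in>I. \<Sum>j\<in>J. d i * c j * inner (F j x) (G i x))"
    unfolding L2_inner_def
  proof (rule integral_cong_AE)
    show "(\<lambda>x. inner (f x) (g x)) \<in> borel_measurable (lebesgue_on \<Omega>)"
      using integrable_inner_ess_bounded[OF f(1) g(1)] by (rule borel_measurable_integrable)
    show "(\<lambda>x. \<Sum>i\<in>I. \<Sum>j\<in>J. d i * c j * inner (F j x) (G i x)) \<in> borel_measurable (lebesgue_on \<Omega>)"
      using FG by (intro borel_measurable_sum borel_measurable_times borel_measurable_const borel_measurable_integrable)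
    show "AE x in lebesgue_on \<Omega>. inner (f x) (g x) = (\<Sum>i\<in>I. \<Sum>j\<in>J. d i * c j * inner (F j x) (G i x))"
      using f(2) g(2)
    proof eventually_elim
      case (elim x)
      show ?case unfolding elim
        by (simp add: inner_sum_right inner_sum_left sum_distrib_left mult.assoc)
    qed
  qed
  also have "\<dots> = (\<Sum>i\<in>I. \<Sum>j\<in>J. d i * c j * L2_inner \<Omega> (F j) (G i))"
    unfolding L2_inner_def using FG
    by (subst Bochner_Integration.integral_sum; (intro sum.cong refl)?)
      (auto intro!: Bochner_Integration.integrable_sum integrable_mult_right simp: Bochner_Integration.integral_sum)
  finally show ?thesis .
qed

end

section \<open>Matrix representation, positivity and unique solvability\<close>

context tangent_plane_step
begin

lemma jacobian_fe_function:
  "AE x in lebesgue_on \<Omega>. jacobian (fe_function c) (at x) = (\<Sum>j<3 * N. vec_index c j *\<^sub>R jacobian (\<phi> j) (at x))"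
  using AE_regular
proof eventually_elim
  case (elim x)
  have "(fe_function c has_derivative (\<lambda>h. \<Sum>j<3 * N. vec_index c j *\<^sub>R (jacobian (\<phi> j) (at x) *v h))) (at x)"
    using P1_3_has_derivative[OF \<phi>_P1_3 elim]
    by (intro has_derivative_sum has_derivative_scaleR_right) auto
  then have "(\<lambda>h. jacobian (fe_function c) (at x) *v h)
      = (\<lambda>h. \<Sum>j<3 * N. vec_index c j *\<^sub>R (jacobian (\<phi> j) (at x) *v h))"
    by (rule has_derivative_unique[OF P1_3_has_derivative[OF fe_function_P1_3 elim]])
  then have *: "jacobian (fe_function c) (at x) *v axis l 1
      = (\<Sum>j<3 * N. vec_index c j *\<^sub>R (jacobian (\<phi> j) (at x) *v axis l 1))" for l
    by (rule fun_cong)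
  have "jacobian (fe_function c) (at x) $ k $ l
      = (\<Sum>j<3 * N. vec_index c j *\<^sub>R jacobian (\<phi> j) (at x)) $ k $ l" for k l
    using arg_cong[OF *[of l], of "\<lambda>v. v $ k"]
    by (simp add: matrix_vector_mul_component inner_axis)
  then show ?case by (simp add: Finite_Cartesian_Product.vec_eq_iff)
qed

lemma ess_bounded_weighted: "u \<in> P1_space3 \<Omega> \<T> \<Longrightarrow> ess_bounded (lebesgue_on \<Omega>) (\<lambda>x. w x *\<^sub>R u x)"
  by (intro ess_bounded_scaleR w_bounded ess_bounded_P1_3)

lemma ess_bounded_cross: "u \<in> P1_space3 \<Omega> \<T> \<Longrightarrow> ess_bounded (lebesgue_on \<Omega>) (\<lambda>x. cross3 (m x) (u x))"
  by (intro ess_bounded_continuous continuous_on_cross P1_3_continuous m_P1_3)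

lemma A_carrier: "A \<in> carrier_mat (3 * N) (3 * N)"
  and b_carrier: "b \<in> carrier_vec (3 * N)"
  by (simp_all add: system_matrix_def minus_carrier_mat cross_matrix_def load_vector_def)

text \<open>The matrices have the trial function at the first index, whereas a matrix acting on
  trial coefficients needs it at the second. Mass and stiffness are symmetric, but transposing the
  cross product term reverses its sign; this is why \<open>system_matrix\<close> subtracts a term
  that the form adds. The factor \<alpha> cancels the division of the weight.\<close>

lemma A_entry:
  assumes "i < 3 * N" "j < 3 * N"
  shows "A $$ (i, j) = lhs_form (\<phi> j) (\<phi> i)"
proof -
  have 1: "\<alpha> * L2_inner \<Omega> (\<lambda>x. (w x / \<alpha>) *\<^sub>R \<phi> i x) (\<phi> j) = L2_inner \<Omega> (\<lambda>x. w x *\<^sub>R \<phi> j x) (\<phi> i)"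
    using \<alpha> unfolding L2_inner_def integral_mult_right_zero[symmetric]
    by (intro Bochner_Integration.integral_cong refl) (simp add: inner_commute)
  have 2: "inner (cross3 (m x) (\<phi> j x)) (\<phi> i x) = - inner (cross3 (m x) (\<phi> i x)) (\<phi> j x)" for x
    by (simp add: cross3_def inner_vec_def sum_3 vector_3 algebra_simps)
  have 2: "L2_inner \<Omega> (\<lambda>x. cross3 (m x) (\<phi> j x)) (\<phi> i) = - L2_inner \<Omega> (\<lambda>x. cross3 (m x) (\<phi> i x)) (\<phi> j)"
    unfolding L2_inner_def 2 by simp
  have 3: "L2_inner \<Omega> (\<lambda>x. jacobian (\<phi> i) (at x)) (\<lambda>x. jacobian (\<phi> j) (at x))
      = L2_inner \<Omega> (\<lambda>x. jacobian (\<phi> j) (at x)) (\<lambda>x. jacobian (\<phi> i) (at x))"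
    unfolding L2_inner_def by (simp add: inner_commute)
  show ?thesis
    using assms unfolding lhs_form_def 2 3[symmetric] 1[symmetric]
    by (simp add: system_matrix_def mass_matrix_def stiffness_matrix_def cross_matrix_def)
qed

lemma lhs_form_fe_function:
  assumes c: "c \<in> carrier_vec (3 * N)" and d: "d \<in> carrier_vec (3 * N)"
  shows "lhs_form (fe_function c) (fe_function d) = scalar_prod d (A *\<^sub>v c)"
proof -
  note fe = fe_function_P1_3
  have bdd: "\<And>j. j \<in> {..<3 * N} \<Longrightarrow> ess_bounded (lebesgue_on \<Omega>) (\<phi> j)"
    "\<And>j. j \<in> {..<3 * N} \<Longrightarrow> ess_bounded (lebesgue_on \<Omega>) (\<lambda>x. w x *\<^sub>R \<phi> j x)"
    "\<And>j. j \<in> {..<3 * N} \<Longrightarrow> ess_bounded (lebesgue_on \<Omega>) (\<lambda>x. cross3 (m x) (\<phi> j x))"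
    "\<And>j. j \<in> {..<3 * N} \<Longrightarrow> ess_bounded (lebesgue_on \<Omega>) (\<lambda>x. jacobian (\<phi> j) (at x))"
    using \<phi>_P1_3 ess_bounded_P1_3 ess_bounded_weighted ess_bounded_cross ess_bounded_jacobian by auto
  have mass: "L2_inner \<Omega> (\<lambda>x. w x *\<^sub>R fe_function c x) (fe_function d)
      = (\<Sum>i<3 * N. \<Sum>j<3 * N. vec_index d i * vec_index c j * L2_inner \<Omega> (\<lambda>x. w x *\<^sub>R \<phi> j x) (\<phi> i))"
    by (rule L2_inner_double_sum)
      (use bdd ess_bounded_weighted[OF fe] ess_bounded_P1_3[OF fe] in \<open>simp_all add: scaleR_sum_right mult.commute\<close>)
  have cross: "L2_inner \<Omega> (\<lambda>x. cross3 (m x) (fe_function c x)) (fe_function d)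
      = (\<Sum>i<3 * N. \<Sum>j<3 * N. vec_index d i * vec_index c j * L2_inner \<Omega> (\<lambda>x. cross3 (m x) (\<phi> j x)) (\<phi> i))"
  proof (rule L2_inner_double_sum)
    have lin: "linear (cross3 (m x))" for x
      using bilinear_cross by (simp add: bilinear_def)
    show "AE x in lebesgue_on \<Omega>. cross3 (m x) (fe_function c x) = (\<Sum>j<3 * N. vec_index c j *\<^sub>R cross3 (m x) (\<phi> j x))"
      by (simp add: linear_sum[OF lin] linear_cmul[OF lin])
  qed (use bdd ess_bounded_cross[OF fe] ess_bounded_P1_3[OF fe] in simp_all)
  have stiff: "L2_inner \<Omega> (\<lambda>x. jacobian (fe_function c) (at x)) (\<lambda>x. jacobian (fe_function d) (at x))
      = (\<Sum>i<3 * N. \<Sum>j<3 * N. vec_index d i * vec_index c j *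
          L2_inner \<Omega> (\<lambda>x. jacobian (\<phi> j) (at x)) (\<lambda>x. jacobian (\<phi> i) (at x)))"
    by (rule L2_inner_double_sum)
      (use bdd ess_bounded_jacobian[OF fe] jacobian_fe_function in simp_all)
  have "lhs_form (fe_function c) (fe_function d)
      = (\<Sum>i<3 * N. \<Sum>j<3 * N. vec_index d i * vec_index c j * lhs_form (\<phi> j) (\<phi> i))"
    unfolding lhs_form_def mass cross stiff sum_distrib_left sum.distrib[symmetric]
    by (intro sum.cong refl) (simp add: algebra_simps)
  also have "\<dots> = (\<Sum>i<3 * N. vec_index d i * (\<Sum>j<3 * N. A $$ (i, j) * vec_index c j))"
    unfolding sum_distrib_left by (intro sum.cong refl) (simp add: A_entry)
  also have "\<dots> = scalar_prod d (A *\<^sub>v c)"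
    using A_carrier c d by (simp add: scalar_prod_def atLeast0LessThan)
  finally show ?thesis .
qed

lemma rhs_form_fe_function:
  assumes d: "d \<in> carrier_vec (3 * N)"
  shows "rhs_form (fe_function d) = scalar_prod d b"
proof -
  have bdd: "ess_bounded (lebesgue_on \<Omega>) (\<phi> j)" "ess_bounded (lebesgue_on \<Omega>) (\<lambda>x. jacobian (\<phi> j) (at x))"
    if "j < 3 * N" for j
    using \<phi>_P1_3[OF that] by (simp_all add: ess_bounded_P1_3 ess_bounded_jacobian)
  have "L2_inner \<Omega> (\<lambda>x. jacobian m (at x)) (\<lambda>x. jacobian (fe_function d) (at x))
      = (\<Sum>i<3 * N. \<Sum>j\<in>{0::nat}. vec_index d i * 1 * L2_inner \<Omega> (\<lambda>x. jacobian m (at x)) (\<lambda>x. jacobian (\<phi> i) (at x)))"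
    \<comment> \<open>The fixed left factor is treated as a sum with a single term of coefficient
      1.\<close>
    by (rule L2_inner_double_sum[where c = "\<lambda>_. 1" and F = "\<lambda>_ x. jacobian m (at x)"])
      (use bdd ess_bounded_jacobian[OF m_P1_3] ess_bounded_jacobian[OF fe_function_P1_3] jacobian_fe_function in simp_all)
  then have 1: "L2_inner \<Omega> (\<lambda>x. jacobian m (at x)) (\<lambda>x. jacobian (fe_function d) (at x))
      = (\<Sum>i<3 * N. vec_index d i * L2_inner \<Omega> (\<lambda>x. jacobian m (at x)) (\<lambda>x. jacobian (\<phi> i) (at x)))"
    by simp
  \<comment> \<open>Here \<open>q\<close> is only square integrable, so the expansion is made in the
    test function alone.\<close>
  have 2: "L2_inner \<Omega> q (fe_function d) = (\<Sum>i<3 * N. vec_index d i * L2_inner \<Omega> q (\<phi> i))"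
    unfolding L2_inner_def inner_sum_right inner_scaleR_right
    using integrable_inner_L2[OF q bdd(1)] by (subst Bochner_Integration.integral_sum) simp_all
  have "rhs_form (fe_function d) = (\<Sum>i<3 * N. vec_index d i * rhs_form (\<phi> i))"
    unfolding rhs_form_def 1 2 sum_distrib_left sum.distrib[symmetric]
    by (intro sum.cong refl) (simp add: algebra_simps)
  also have "\<dots> = scalar_prod d b"
    using b_carrier by (simp add: scalar_prod_def atLeast0LessThan) (simp add: load_vector_def rhs_form_def)
  finally show ?thesis .
qed

text \<open>If the weighted mass vanished, \<open>u\<close> would be zero almost everywhere in
  \<Omega>. Its nonzero set there is open and an open null set is empty; continuity extends the zero
  to the closure, and outside \<open>u\<close> is zero anyway.\<close>

lemma lhs_form_pos:
  assumes u: "u \<in> P1_space3 \<Omega> \<T>" and u0: "u \<noteq> (\<lambda>_. 0)"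
  shows "0 < lhs_form u u"
proof -
  have nonneg: "0 \<le> inner (w x *\<^sub>R u x) (u x)" for x
    using w_pos[of x] by simp
  have int: "integrable (lebesgue_on \<Omega>) (\<lambda>x. inner (w x *\<^sub>R u x) (u x))"
    by (rule integrable_inner_ess_bounded[OF ess_bounded_weighted[OF u] ess_bounded_P1_3[OF u]])
  have "L2_inner \<Omega> (\<lambda>x. w x *\<^sub>R u x) u \<noteq> 0"
  proof
    assume "L2_inner \<Omega> (\<lambda>x. w x *\<^sub>R u x) u = 0"
    then have "AE x in lebesgue_on \<Omega>. inner (w x *\<^sub>R u x) (u x) = 0"
      unfolding L2_inner_def using integral_nonneg_eq_0_iff_AE[OF int] nonneg by simp
    then have "AE x in lebesgue_on \<Omega>. u x = 0"
      by eventually_elim (use w_pos in \<open>auto simp: less_imp_neq[symmetric]\<close>)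
    then have "AE x in lebesgue. x \<in> \<Omega> \<longrightarrow> u x = 0"
      using domain_sets by (simp add: AE_restrict_space_iff)
    then have "{x. \<not> (x \<in> \<Omega> \<longrightarrow> u x = 0)} \<in> null_sets lebesgue"
      using AE_iff_null_sets by (simp add: completion.AE_iff_null_sets)
    moreover have "{x. \<not> (x \<in> \<Omega> \<longrightarrow> u x = 0)} = \<Omega> \<inter> u -` (- {0})" by auto
    ultimately have "negligible (\<Omega> \<inter> u -` (- {0}))" by (simp add: negligible_iff_null_sets)
    moreover have "open (\<Omega> \<inter> u -` (- {0}))"
      using continuous_on_subset[OF P1_3_continuous[OF u] closure_subset] open_domain
      by (intro continuous_open_preimage) auto
    ultimately have "\<Omega> \<inter> u -` (- {0}) = {}" using open_not_negligible by blast
    then have "u x = 0" if "x \<in> closure \<Omega>" for x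
      by (intro continuous_constant_on_closure[OF P1_3_continuous[OF u] _ that]) auto
    moreover have "u x = 0" if "x \<notin> closure \<Omega>" for x
      using u that by (simp add: Finite_Cartesian_Product.vec_eq_iff P1_space3_def P1_space_def)
    ultimately show False using u0 by blast
  qed
  moreover have "0 \<le> L2_inner \<Omega> (\<lambda>x. w x *\<^sub>R u x) u"
    unfolding L2_inner_def using nonneg by (rule Bochner_Integration.integral_nonneg)
  moreover have "L2_inner \<Omega> (\<lambda>x. cross3 (m x) (u x)) u = 0"
    unfolding L2_inner_def by (simp add: dot_cross_self)
  moreover have "0 \<le> L2_inner \<Omega> (\<lambda>x. jacobian u (at x)) (\<lambda>x. jacobian u (at x))"
    unfolding L2_inner_def by (intro Bochner_Integration.integral_nonneg) simp
  ultimately show ?thesis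
    using \<kappa> unfolding lhs_form_def by (simp add: add_pos_nonneg)
qed

lemma Q_carrier: "Q \<in> carrier_mat (3 * N) (2 * N)" by (rule tangent_matrix_carrier)

lemma Qx_carrier: "x \<in> carrier_vec (2 * N) \<Longrightarrow> Q *\<^sub>v x \<in> carrier_vec (3 * N)"
  using Q_carrier by (rule mult_mat_vec_carrier)

lemma B_carrier: "B \<in> carrier_mat (2 * N) (2 * N)"
  using A_carrier Q_carrier by (meson mult_carrier_mat transpose_carrier_mat)

lemma QTb_carrier: "transpose_mat Q *\<^sub>v b \<in> carrier_vec (2 * N)"
  using Q_carrier b_carrier by (meson mult_mat_vec_carrier transpose_carrier_mat)

lemma scalar_prod_Q:
  assumes "y \<in> carrier_vec (2 * N)" "c \<in> carrier_vec (3 * N)"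
  shows "scalar_prod (Q *\<^sub>v y) c = scalar_prod y (transpose_mat Q *\<^sub>v c)"
  using transpose_vec_mult_scalar[OF Q_carrier assms]
    comm_scalar_prod[of "Q *\<^sub>v y" "3 * N" c] comm_scalar_prod[of y "2 * N" "transpose_mat Q *\<^sub>v c"]
    assms Qx_carrier Q_carrier
  by (metis mult_mat_vec_carrier transpose_carrier_mat)

lemma B_mult:
  assumes "x \<in> carrier_vec (2 * N)"
  shows "B *\<^sub>v x = transpose_mat Q *\<^sub>v (A *\<^sub>v (Q *\<^sub>v x))"
proof -
  have QT: "transpose_mat Q \<in> carrier_mat (2 * N) (3 * N)" using Q_carrier by simp
  have "B *\<^sub>v x = (transpose_mat Q * A) *\<^sub>v (Q *\<^sub>v x)"
    by (rule assoc_mult_mat_vec[OF mult_carrier_mat[OF QT A_carrier] Q_carrier assms])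
  also have "\<dots> = transpose_mat Q *\<^sub>v (A *\<^sub>v (Q *\<^sub>v x))"
    by (rule assoc_mult_mat_vec[OF QT A_carrier Qx_carrier[OF assms]])
  finally show ?thesis .
qed

lemma lhs_form_tangent:
  assumes x: "x \<in> carrier_vec (2 * N)" and y: "y \<in> carrier_vec (2 * N)"
  shows "lhs_form (fe_function (Q *\<^sub>v x)) (fe_function (Q *\<^sub>v y)) = scalar_prod y (B *\<^sub>v x)"
  unfolding lhs_form_fe_function[OF Qx_carrier[OF x] Qx_carrier[OF y]] B_mult[OF x]
  by (rule scalar_prod_Q[OF y mult_mat_vec_carrier[OF A_carrier Qx_carrier[OF x]]])

lemma rhs_form_tangent:
  assumes y: "y \<in> carrier_vec (2 * N)"
  shows "rhs_form (fe_function (Q *\<^sub>v y)) = scalar_prod y (transpose_mat Q *\<^sub>v b)"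
  unfolding rhs_form_fe_function[OF Qx_carrier[OF y]] by (rule scalar_prod_Q[OF y b_carrier])

lemma positive_definite_B: "positive_definite_mat B"
  unfolding positive_definite_mat_def
proof (intro conjI ballI impI)
  show "square_mat B" using B_carrier by (simp only: square_mat.simps carrier_matD)
  have dim: "dim_row B = 2 * N" using B_carrier by (rule carrier_matD)
  fix x :: "real Matrix.vec"
  assume "x \<in> carrier_vec (dim_row B)" "x \<noteq> 0\<^sub>v (dim_row B)"
  then have x: "x \<in> carrier_vec (2 * N)" "x \<noteq> 0\<^sub>v (2 * N)" unfolding dim .
  have "Q *\<^sub>v 0\<^sub>v (2 * N) = 0\<^sub>v (3 * N)" using Q_carrier by (intro eq_vecI) auto
  then have "fe_function (Q *\<^sub>v 0\<^sub>v (2 * N)) = (\<lambda>_. 0)" by simp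
  then have "fe_function (Q *\<^sub>v x) \<noteq> (\<lambda>_. 0)"
    using fe_function_tangent_inj[OF x(1), of "0\<^sub>v (2 * N)"] x(2) by auto
  from lhs_form_pos[OF fe_function_P1_3 this] show "0 < scalar_prod x (B *\<^sub>v x)"
    unfolding lhs_form_tangent[OF x(1) x(1)] .
qed

text \<open>Testing with the discrete tangent space is testing with all coefficient vectors
  \<open>y\<close>, since these parametrize it.\<close>

lemma is_v_iff:
  assumes x: "x \<in> carrier_vec (2 * N)"
  shows "is_v (fe_function (Q *\<^sub>v x)) \<longleftrightarrow> is_x x"
proof -
  have Bx: "B *\<^sub>v x \<in> carrier_vec (2 * N)" using B_carrier x by (rule mult_mat_vec_carrier)
  have K: "fe_function (Q *\<^sub>v x) \<in> K_space \<Omega> \<T> m"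
    unfolding K_space_eq using x by (rule imageI)
  have "is_v (fe_function (Q *\<^sub>v x)) \<longleftrightarrow>
      (\<forall>v\<in>K_space \<Omega> \<T> m. lhs_form (fe_function (Q *\<^sub>v x)) v = rhs_form v)"
    unfolding variational_solution_def lhs_form_def rhs_form_def using K by blast
  also have "\<dots> \<longleftrightarrow> (\<forall>y\<in>carrier_vec (2 * N).
      lhs_form (fe_function (Q *\<^sub>v x)) (fe_function (Q *\<^sub>v y)) = rhs_form (fe_function (Q *\<^sub>v y)))"
    by (simp only: K_space_eq Set.ball_simps)
  also have "\<dots> \<longleftrightarrow> (\<forall>y\<in>carrier_vec (2 * N). scalar_prod y (B *\<^sub>v x) = scalar_prod y (transpose_mat Q *\<^sub>v b))"
    by (rule ball_cong[OF refl]) (simp only: lhs_form_tangent[OF x] rhs_form_tangent)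
  also have "\<dots> \<longleftrightarrow> B *\<^sub>v x = transpose_mat Q *\<^sub>v b"
  proof
    assume *: "\<forall>y\<in>carrier_vec (2 * N). scalar_prod y (B *\<^sub>v x) = scalar_prod y (transpose_mat Q *\<^sub>v b)"
    show "B *\<^sub>v x = transpose_mat Q *\<^sub>v b"
    proof (rule eq_vecI)
      show "dim_vec (B *\<^sub>v x) = dim_vec (transpose_mat Q *\<^sub>v b)"
        using Bx QTb_carrier by (simp only: carrier_vecD)
      fix i assume "i < dim_vec (transpose_mat Q *\<^sub>v b)"
      then have i: "i < 2 * N" using QTb_carrier by (simp only: carrier_vecD)
      show "vec_index (B *\<^sub>v x) i = vec_index (transpose_mat Q *\<^sub>v b) i"
        \<comment> \<open>Choosing a unit vector for \<open>y\<close> isolates one equation of the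
          system.\<close>
        using *[rule_format, OF unit_vec_carrier, of i]
        unfolding scalar_prod_left_unit[OF Bx i] scalar_prod_left_unit[OF QTb_carrier i] .
    qed
  qed simp
  finally show ?thesis using x by simp
qed

lemma invertible_B: "invertible_mat B"
  by (rule positive_definite_mat_invertible[OF B_carrier positive_definite_B])

lemma ex1_is_x: "\<exists>!x. is_x x"
  by (rule invertible_mat_unique_solution[OF B_carrier invertible_B QTb_carrier])

text \<open>A solution lies in the tangent space and so has coefficients \<open>y\<close>; these
  solve the regular linear system and must equal \<open>x\<close>.\<close>

lemma is_v_coefficients:
  assumes "is_x x" "is_v v"
  shows "v = fe_function (Q *\<^sub>v x)"
proof -
  obtain y where y: "y \<in> carrier_vec (2 * N)" "v = fe_function (Q *\<^sub>v y)"
    using assms(2) unfolding variational_solution_def K_space_eq by blast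
  then have "is_x y" using is_v_iff assms(2) by blast
  then show ?thesis using ex1_is_x assms(1) y(2) by blast
qed

lemma ex1_is_v: "\<exists>!v. is_v v"
proof -
  obtain x where x: "is_x x" using ex1_is_x by blast
  then have "is_v (fe_function (Q *\<^sub>v x))" using is_v_iff by blast
  then show ?thesis using is_v_coefficients[OF x] by blast
qed

end

theorem theorem3:
  fixes \<Omega> :: "(real^3) set" and \<T> :: "(real^3) set set" and Cmesh h :: real
    and N :: nat and z :: "nat \<Rightarrow> real^3"
    and \<alpha> lx T k :: real and M n :: nat
    and P :: "(real^3 \<Rightarrow> real^3) \<Rightarrow> real^3 \<Rightarrow> real^3"
    and f :: "real \<Rightarrow> real^3 \<Rightarrow> real^3"
    and \<beta> :: "real \<Rightarrow> real" and W :: "real \<Rightarrow> real \<Rightarrow> real"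
    and Lh :: "(real^3 \<Rightarrow> real^3) \<Rightarrow> (real^3 \<Rightarrow> real^3) \<Rightarrow> real^3 \<Rightarrow> real^3"
    and Tn :: "real^3^3"
    and m mprev :: "real^3 \<Rightarrow> real^3"
  assumes domain: "bounded_Lipschitz_domain \<Omega>"
    and mesh: "tetrahedral_mesh \<Omega> \<T>" "0 < h" "quasi_uniform \<T> Cmesh h"
    and enumeration: "bij_betw z {..<N} (nodes \<T>)"
    and params: "0 < \<alpha>" "\<alpha> \<le> 1" "0 < lx" "0 < T"
    and time_steps: "0 < M" "k = T / real M" "n < M"
    and operator: "bounded_H1_L2 \<Omega> P"
    and field: "C1_into_L2 \<Omega> T f"
    and \<beta>_pos: "\<And>s. 0 < s \<Longrightarrow> 0 < \<beta> s"
    and \<beta>_lim: "((\<lambda>s. \<beta> s * s) \<longlongrightarrow> 0) (at_right 0)"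
    and W_fun: "\<And>s. 0 < s \<Longrightarrow> W s \<in> borel_measurable borel"
      "\<And>s. 0 < s \<Longrightarrow> bounded (range (W s))"
      "\<And>s r. 0 < s \<Longrightarrow> 0 < W s r"
    and W_lim: "((\<lambda>s. esssup lborel (\<lambda>r. ereal \<bar>W s r - \<alpha>\<bar>)) \<longlongrightarrow> 0) (at_right 0)"
    and W_inf: "(INF s\<in>{0<..}. INF r. W s r) \<ge> \<alpha> / 2"
    and Tn: "invertible Tn" "Tn = matrix_inv Tn" "Tn = transpose Tn"
    and m: "m \<in> M_space \<Omega> \<T>" and mprev: "mprev \<in> M_space \<Omega> \<T>"
    and lower_order: "Lh m mprev \<in> L2_space \<Omega>"
  shows
    "let \<phi> = nodal_basis \<Omega> \<T> z;
         w = (\<lambda>x. W k (lambda_h lx (f (k * real n)) P m x));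
         \<kappa> = \<beta> k * k;
         A = system_matrix \<Omega> N \<phi> \<alpha> \<kappa> w m;
         b = load_vector \<Omega> N \<phi> lx (Lh m mprev) m;
         Q = tangent_matrix N z Tn m;
         B = transpose_mat Q * A * Q;
         is_x = (\<lambda>x. x \<in> carrier_vec (2 * N) \<and> B *\<^sub>v x = transpose_mat Q *\<^sub>v b);
         is_v = variational_solution \<Omega> \<T> lx \<kappa> w (Lh m mprev) m
     in A \<in> carrier_mat (3 * N) (3 * N) \<and> b \<in> carrier_vec (3 * N) \<and>
        Q \<in> carrier_mat (3 * N) (2 * N) \<and> B \<in> carrier_mat (2 * N) (2 * N) \<and>
        positive_definite_mat B \<and> invertible_mat B \<and>
        (\<exists>!x. is_x x) \<and> (\<exists>!v. is_v v) \<and>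
        (\<forall>x v. is_x x \<longrightarrow> is_v v \<longrightarrow>
           v = (\<lambda>y. \<Sum>j<3 * N. vec_index (Q *\<^sub>v x) j *\<^sub>R \<phi> j y))"
proof -
  interpret tet_mesh \<Omega> \<T>
    using domain mesh(1) by unfold_locales (auto simp: bounded_Lipschitz_domain_def)
  have k: "0 < k" using params(4) time_steps(1,2) by simp
  have "k * real n \<le> k * real M" using k time_steps(3) by (intro mult_left_mono) simp_all
  also have "k * real M = T" using time_steps(1,2) by simp
  \<comment> \<open>Membership of \<open>f t\<close> in the square integrable functions is available
    only for times in this interval.\<close>
  finally have t: "k * real n \<in> {0..T}" using k by simp
  have m': "m \<in> P1_space3 \<Omega> \<T>" using m by (simp add: M_space_def)
  define w where "w = (\<lambda>x. W k (lambda_h lx (f (k * real n)) P m x))"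
  have "(\<lambda>x. lambda_h lx (f (k * real n)) P m x) \<in> borel_measurable (lebesgue_on \<Omega>)"
  proof -
    have "f (k * real n) \<in> borel_measurable (lebesgue_on \<Omega>)"
      using field t unfolding C1_into_L2_def L2_space_def by blast
    moreover have "P m \<in> borel_measurable (lebesgue_on \<Omega>)"
      using operator P1_3_H1[OF m'] unfolding bounded_H1_L2_def L2_space_def by blast
    moreover have "m \<in> borel_measurable (lebesgue_on \<Omega>)"
      "(\<lambda>x. jacobian m (at x)) \<in> borel_measurable (lebesgue_on \<Omega>)"
      using ess_bounded_P1_3[OF m'] ess_bounded_jacobian[OF m'] by (simp_all add: ess_bounded_def)
    ultimately show ?thesis
      unfolding lambda_h_def
      by (intro borel_measurable_add borel_measurable_times borel_measurable_const borel_measurable_power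
          measurable_compose[OF _ borel_measurable_norm] borel_measurable_inner)
  qed
  then have w_meas: "w \<in> borel_measurable (lebesgue_on \<Omega>)"
    unfolding w_def using W_fun(1)[OF k] by (rule measurable_compose)
  obtain C where "\<And>r. norm (W k r) \<le> C"
    using W_fun(2)[OF k] by (auto simp: bounded_iff)
  then have w_bdd: "ess_bounded (lebesgue_on \<Omega>) w"
    using w_meas by (intro ess_boundedI[where B = C]) (simp_all add: w_def)
  \<comment> \<open>\<open>matrix_inv\<close> is a choice operator; invertibility guarantees that it
    picks a genuine inverse, which by assumption is \<open>Tn\<close> itself.\<close>
  have Tn2: "Tn ** Tn = Finite_Cartesian_Product.mat 1"
  proof -
    have "\<exists>A'. Tn ** A' = Finite_Cartesian_Product.mat 1 \<and> A' ** Tn = Finite_Cartesian_Product.mat 1"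
      using Tn(1) by (simp add: invertible_def)
    then have "Tn ** matrix_inv Tn = Finite_Cartesian_Product.mat 1"
      unfolding matrix_inv_def by (rule someI2_ex) simp
    then show ?thesis using Tn(2) by simp
  qed
  interpret tangent_plane_step \<Omega> \<T> N z Tn m lx \<alpha> "\<beta> k * k" w "Lh m mprev"
  proof unfold_locales
    show "transpose Tn = Tn" using Tn(3) by simp
    show "0 \<le> \<beta> k * k" using \<beta>_pos[OF k] k by simp
    show "0 < w x" for x unfolding w_def by (rule W_fun(3)[OF k])
  qed (use enumeration Tn2 m params(1) w_bdd lower_order in simp_all)
  show ?thesis
    unfolding Let_def w_def[symmetric]
    using A_carrier b_carrier Q_carrier B_carrier positive_definite_B invertible_B
      ex1_is_x ex1_is_v is_v_coefficients
    by blast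
qed

end
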